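(* Let $D$ be a Jordan domain in $\mathbb C$ and let $\lambda:\partial D\to\mathbb C$ with $|\lambda(\zeta)|=1$ for all $\zeta$, and $\varphi:\partial D\to\mathbb R$ be functions measurable with respect to harmonic measures in $D$. Let $S$ be the set of all analytic functions $f:D\to\mathbb C$ such that for almost every $\zeta\in\partial D$ with respect to harmonic measures in $D$, the function $z\mapsto\mathrm{Re}\,\{\overline{\lambda(\zeta)}\cdot f(z)\}$ has a unique principal asymptotic value at $\zeta$, equal to $\varphi(\zeta)$. Then $S$ has infinite dimension, i.e. the real linear span of the differences $f_1-f_2$, $f_1,f_2\in S$, is infinite-dimensional.
   Context: Let $\omega:D\to\mathbb D$ be a conformal map onto the unit disk, extended (by Carathéodory's theorem) to a homeomorphism $\overline D\to\overline{\mathbb D}$. A set $\mathcal E\subseteq\partial D$ is measurable with respect to harmonic measures in $D$ if $\omega(\mathcal E)$ is Lebesgue measurable on $\partial\mathbb D$; it has harmonic measure zero if $|\omega(\mathcal E)|=0$; a function $\psi$ on $\partial D$ is measurable with respect to harmonic measures if $\psi\circ\omega^{-1}$ is Lebesgue measurable on $\partial\mathbb D$, and "almost every with respect to harmonic measures" means outside a set of harmonic measure zero. For $\Omega:D\to\overline{\mathbb C}$, $\zeta\in\partial D$ and an arc $\gamma$ in $D$ terminating at $\zeta$, $C(\Omega,\gamma)=\{w\in\overline{\mathbb C}: \Omega(z_n)\to w \text{ for some } z_n\in\gamma,\ z_n\to\zeta\}$; the set of principal asymptotic values is $P(\Omega,\zeta)=\bigcap_\gamma C(\Omega,\gamma)$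 over all arcs $\gamma$ in $D$ terminating at $\zeta$. "Unique principal asymptotic value equal to $c$" means $P(\Omega,\zeta)=\{c\}$. The set $S$ is a real affine space; its dimension is that of the real linear space spanned by differences of its elements. *)

theory Defs
  imports "HOL-Analysis.Analysis"
begin

definition jordan_domain :: "complex set \<Rightarrow> bool" where
  "jordan_domain D \<longleftrightarrow>
     (\<exists>g::real \<Rightarrow> complex. simple_path g \<and> pathstart g = pathfinish g \<and> D = inside (path_image g))"

definition conformal_ext :: "complex set \<Rightarrow> (complex \<Rightarrow> complex) \<Rightarrow> bool" where
  "conformal_ext D \<omega> \<longleftrightarrow>
     \<omega> holomorphic_on D \<and> inj_on \<omega> D \<and> \<omega> ` D = ball 0 1 \<and>
     (\<exists>\<omega>'. homeomorphism (closure D) (cball 0 1) \<omega> \<omega>')"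

definition circle_null :: "complex set \<Rightarrow> bool" where
  "circle_null A \<longleftrightarrow> {t \<in> {0..2*pi}. cis t \<in> A} \<in> null_sets lebesgue"

definition circle_measurable_fun :: "(complex \<Rightarrow> 'b::topological_space) \<Rightarrow> bool" where
  "circle_measurable_fun h \<longleftrightarrow> (\<lambda>t. h (cis t)) \<in> borel_measurable (lebesgue_on {0..2*pi})"

definition hm_null :: "complex set \<Rightarrow> (complex \<Rightarrow> complex) \<Rightarrow> complex set \<Rightarrow> bool" where
  "hm_null D \<omega> E \<longleftrightarrow> circle_null (\<omega> ` E)"

definition hm_measurable_fun ::
  "complex set \<Rightarrow> (complex \<Rightarrow> complex) \<Rightarrow> (complex \<Rightarrow> 'b::topological_space) \<Rightarrow> bool" where
  "hm_measurable_fun D \<omega> \<psi> \<longleftrightarrow> circle_measurable_fun (\<lambda>w. \<psi> (inv_into (closure D) \<omega> w))"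

definition arc_to :: "complex set \<Rightarrow> complex \<Rightarrow> (real \<Rightarrow> complex) \<Rightarrow> bool" where
  "arc_to D \<zeta> \<gamma> \<longleftrightarrow> arc \<gamma> \<and> \<gamma> ` {0..<1} \<subseteq> D \<and> pathfinish \<gamma> = \<zeta>"

text \<open>Cluster set along an arc, with values in the Riemann sphere: Some w is a finite value,
  None is the point at infinity.\<close>
definition cluster_along ::
  "(complex \<Rightarrow> complex) \<Rightarrow> (real \<Rightarrow> complex) \<Rightarrow> complex \<Rightarrow> complex option set" where
  "cluster_along \<Omega> \<gamma> \<zeta> =
     {Some w | w. \<exists>z. (\<forall>n. z n \<in> \<gamma> ` {0..<1}) \<and> z \<longlonglongrightarrow> \<zeta> \<and> (\<lambda>n. \<Omega> (z n)) \<longlonglongrightarrow> w}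
   \<union> {None | u::unit. \<exists>z. (\<forall>n. z n \<in> \<gamma> ` {0..<1}) \<and> z \<longlonglongrightarrow> \<zeta> \<and>
                        filterlim (\<lambda>n. norm (\<Omega> (z n))) at_top sequentially}"

definition principal_asymptotic_values ::
  "complex set \<Rightarrow> (complex \<Rightarrow> complex) \<Rightarrow> complex \<Rightarrow> complex option set" where
  "principal_asymptotic_values D \<Omega> \<zeta> = (\<Inter>\<gamma> \<in> {\<gamma>. arc_to D \<zeta> \<gamma>}. cluster_along \<Omega> \<gamma> \<zeta>)"

definition classS ::
  "complex set \<Rightarrow> (complex \<Rightarrow> complex) \<Rightarrow> (complex \<Rightarrow> complex) \<Rightarrow> (complex \<Rightarrow> real)
     \<Rightarrow> (complex \<Rightarrow> complex) set" where
  "classS D \<omega> lam \<phi> = {f. f holomorphic_on D \<and>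
     (\<exists>E. E \<subseteq> frontier D \<and> hm_null D \<omega> E \<and>
        (\<forall>\<zeta> \<in> frontier D - E.
           principal_asymptotic_values D (\<lambda>z. complex_of_real (Re (cnj (lam \<zeta>) * f z))) \<zeta>
             = {Some (complex_of_real (\<phi> \<zeta>))}))}"

end

theory Submission
  imports Defs "HOL-Complex_Analysis.Complex_Analysis"
begin

text \<open>Every measurable \<open>H\<close> on the unit circle is almost everywhere the radial limit of some
  holomorphic \<open>F\<close> on the disk. For \<open>H = (\<lambda> \<circ> \<omega>\<^sup>-\<^sup>1) (\<phi> \<circ> \<omega>\<^sup>-\<^sup>1 + i k)\<close> with a real measurable \<open>k\<close> one has
  \<open>Re (cnj \<lambda> H) = \<phi>\<close>, so that \<open>F \<circ> \<omega>\<close> has the prescribed limits along the preimages of almost all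
  radii. That no arc misses them is the ambiguous point theorem, which applies to the single function
  \<open>F\<close>, though not to \<open>Re (cnj (\<lambda> \<zeta>) f)\<close>, a function depending on \<open>\<zeta>\<close>. Taking for \<open>k\<close> the
  indicators of \<open>n\<close> disjoint arcs gives \<open>n\<close> independent differences of solutions.

  The function \<open>F\<close> is a sum of polynomials \<open>p\<^sub>n\<close>, where \<open>p\<^sub>n\<close> is close to
  \<open>H - (p\<^sub>0 + \<dots> + p\<^sub>n\<^sub>-\<^sub>1)\<close> on most of the circle, small on a large disk, and along most radii bounded
  by a constant \<open>C\<^sub>n\<close>, known in advance, times the boundary value it approximates.\<close>

section \<open>Polynomial cutoff functions\<close>

text \<open>For compact \<open>K\<close> this is membership in the uniform closure of the
  polynomials on \<open>K\<close>. Only the values of \<open>f\<close> on \<open>K\<close> matter,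
  so poles off \<open>K\<close> are allowed.\<close>

definition poly_approximable :: "complex set \<Rightarrow> (complex \<Rightarrow> complex) \<Rightarrow> bool" where
  "poly_approximable K f \<longleftrightarrow> (\<forall>\<epsilon>>0. \<exists>p. \<forall>z\<in>K. norm (f z - poly p z) < \<epsilon>)"

section \<open>The uniform closure of the polynomials is an algebra\<close>

lemma poly_approximable_poly: "poly_approximable K (poly p)"
  unfolding poly_approximable_def by (auto intro!: exI[of _ p])

lemma poly_approximable_cong:
  "poly_approximable K f \<Longrightarrow> (\<And>z. z \<in> K \<Longrightarrow> f z = g z) \<Longrightarrow> poly_approximable K g"
  unfolding poly_approximable_def by metis

lemma poly_approximable_add:
  assumes "poly_approximable K f" "poly_approximable K g"
  shows "poly_approximable K (\<lambda>z. f z + g z)"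
  unfolding poly_approximable_def
proof (intro allI impI)
  fix \<epsilon> :: real assume "\<epsilon> > 0"
  then obtain p q where p: "\<forall>z\<in>K. norm (f z - poly p z) < \<epsilon>/2" and q: "\<forall>z\<in>K. norm (g z - poly q z) < \<epsilon>/2"
    using assms unfolding poly_approximable_def by (meson half_gt_zero)
  have "norm (f z + g z - poly (p + q) z) < \<epsilon>" if "z \<in> K" for z
  proof -
    have "f z + g z - poly (p + q) z = (f z - poly p z) + (g z - poly q z)" by simp
    also have "norm \<dots> < \<epsilon>/2 + \<epsilon>/2"
      using p q that by (intro norm_triangle_lt add_strict_mono) auto
    finally show ?thesis by simp
  qed
  then show "\<exists>p. \<forall>z\<in>K. norm (f z + g z - poly p z) < \<epsilon>" by blast
qed

lemma poly_approximable_bounded: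
  assumes "compact K" "poly_approximable K f"
  obtains B where "B > 0" "\<forall>z\<in>K. norm (f z) \<le> B"
proof -
  obtain p where p: "\<forall>z\<in>K. norm (f z - poly p z) < 1"
    using assms(2) unfolding poly_approximable_def by (meson zero_less_one)
  have "compact (poly p ` K)"
    using assms(1) by (intro compact_continuous_image continuous_intros)
  then obtain B where B: "B > 0" "\<forall>x\<in>K. norm (poly p x) \<le> B"
    by (auto dest!: compact_imp_bounded simp: bounded_pos)
  show ?thesis
  proof (rule that[of "B + 1"])
    show "\<forall>z\<in>K. norm (f z) \<le> B + 1"
    proof
      fix z assume "z \<in> K"
      then show "norm (f z) \<le> B + 1"
        using p B norm_triangle_sub[of "f z" "poly p z"] by fastforce
    qed
  qed (use B in auto)
qed

lemma poly_approximable_mult: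
  assumes K: "compact K" and f: "poly_approximable K f" and g: "poly_approximable K g"
  shows "poly_approximable K (\<lambda>z. f z * g z)"
  unfolding poly_approximable_def
proof (intro allI impI)
  fix \<epsilon> :: real assume "\<epsilon> > 0"
  obtain B where B: "B > 0" "\<forall>z\<in>K. norm (g z) \<le> B"
    by (rule poly_approximable_bounded[OF K g]) (rule that)
  obtain p where p: "\<forall>z\<in>K. norm (f z - poly p z) < \<epsilon>/(2*B)"
    using f B \<open>\<epsilon> > 0\<close> unfolding poly_approximable_def by (meson divide_pos_pos mult_pos_pos zero_less_numeral)
  \<comment> \<open>The second error gets multiplied by the approximant \<open>p\<close>, so
    \<open>q\<close> is chosen after \<open>p\<close> and relative to a bound for
    \<open>p\<close>.\<close>
  obtain C where C: "C > 0" "\<forall>z\<in>K. norm (poly p z) \<le> C"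
    by (rule poly_approximable_bounded[OF K poly_approximable_poly]) (rule that)
  obtain q where q: "\<forall>z\<in>K. norm (g z - poly q z) < \<epsilon>/(2*C)"
    using g C \<open>\<epsilon> > 0\<close> unfolding poly_approximable_def by (meson divide_pos_pos mult_pos_pos zero_less_numeral)
  have "norm (f z * g z - poly (p * q) z) < \<epsilon>" if z: "z \<in> K" for z
  proof -
    have "norm (f z * g z - poly (p * q) z)
        = norm ((f z - poly p z) * g z + poly p z * (g z - poly q z))"
      by (simp add: algebra_simps)
    also have "\<dots> \<le> norm (f z - poly p z) * norm (g z) + norm (poly p z) * norm (g z - poly q z)"
      by (metis norm_mult norm_triangle_ineq)
    also have "\<dots> < \<epsilon>/(2*B) * B + C * (\<epsilon>/(2*C))"
    proof (rule add_less_le_mono)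
      have "norm (f z - poly p z) * norm (g z) \<le> norm (f z - poly p z) * B"
        using B z by (simp add: mult_left_mono)
      also have "\<dots> < \<epsilon>/(2*B) * B"
        using B(1) p z by (intro mult_strict_right_mono) auto
      finally show "norm (f z - poly p z) * norm (g z) < \<epsilon>/(2*B) * B" .
      show "norm (poly p z) * norm (g z - poly q z) \<le> C * (\<epsilon>/(2*C))"
        using C z q by (intro mult_mono) (auto simp: less_imp_le)
    qed
    also have "\<dots> = \<epsilon>" using B C by simp
    finally show ?thesis .
  qed
  then show "\<exists>p. \<forall>z\<in>K. norm (f z * g z - poly p z) < \<epsilon>" by blast
qed

lemma poly_approximable_uniform_limit:
  assumes "\<And>n::nat. poly_approximable K (g n)" "uniform_limit K g f sequentially"
  shows "poly_approximable K f"
  unfolding poly_approximable_def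
proof (intro allI impI)
  fix \<epsilon> :: real assume "\<epsilon> > 0"
  then obtain n where n: "\<forall>z\<in>K. dist (g n z) (f z) < \<epsilon>/2"
    using uniform_limitD[OF assms(2), of "\<epsilon>/2"] by (auto simp: eventually_sequentially)
  obtain p where p: "\<forall>z\<in>K. norm (g n z - poly p z) < \<epsilon>/2"
    using assms(1)[of n] \<open>\<epsilon> > 0\<close> unfolding poly_approximable_def by (meson half_gt_zero)
  have "norm (f z - poly p z) < \<epsilon>" if "z \<in> K" for z
    using n p that norm_triangle_lt[of "f z - g n z" "g n z - poly p z" \<epsilon>]
    by (fastforce simp: dist_norm norm_minus_commute)
  then show "\<exists>p. \<forall>z\<in>K. norm (f z - poly p z) < \<epsilon>" by blast
qed

section \<open>Geometric series and Runge's pushing of poles\<close>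

text \<open>The remainder after \<open>n\<close> terms is
  \<open>u z ^ n * (v z / (1 - u z))\<close>, bounded on \<open>K\<close> by
  \<open>k ^ n * (M / (1 - k))\<close>.\<close>

lemma geometric_kernel_uniform_limit:
  fixes a b :: complex
  assumes "\<And>z. z \<in> K \<Longrightarrow> norm (u z) \<le> k" "k < 1" "\<And>z. z \<in> K \<Longrightarrow> norm (v z) \<le> M"
  shows "uniform_limit K (\<lambda>n z. (\<Sum>i<n. u z ^ i) * v z) (\<lambda>z. v z / (1 - u z :: complex)) sequentially"
proof (cases "K = {}")
  case False
  then obtain z0 where "z0 \<in> K" by auto
  then have k: "k \<ge> 0" and M: "M \<ge> 0"
    using assms(1,3)[of z0] norm_ge_zero[of "u z0"] norm_ge_zero[of "v z0"] by linarith+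
  have "(\<lambda>n. k ^ n * (M / (1 - k))) \<longlonglongrightarrow> 0 * (M / (1 - k))"
    using k assms(2) by (intro tendsto_intros LIMSEQ_power_zero) auto
  then have lim: "(\<lambda>n. k ^ n * (M / (1 - k))) \<longlonglongrightarrow> 0" by simp
  show ?thesis
  proof (rule uniform_limitI)
    fix e :: real assume "e > 0"
    then have "\<forall>\<^sub>F n in sequentially. k ^ n * (M / (1 - k)) < e"
      using lim by (rule order_tendstoD(2)[rotated])
    then show "\<forall>\<^sub>F n in sequentially. \<forall>z\<in>K. dist ((\<Sum>i<n. u z ^ i) * v z) (v z / (1 - u z)) < e"
    proof eventually_elim
      case (elim n)
      show ?case
      proof
        fix z assume z: "z \<in> K"
        have u: "norm (u z) \<le> k" using assms z by auto
        then have ne: "u z \<noteq> 1" using assms(2) by auto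
        have low: "1 - k \<le> norm (1 - u z)"
          using u norm_triangle_ineq2[of 1 "u z"] by simp
        have "(\<Sum>i<n. u z ^ i) = (1 - u z ^ n) / (1 - u z)"
          using ne by (simp add: sum_gp_strict)
        then have "(\<Sum>i<n. u z ^ i) * v z - v z / (1 - u z) = - (u z ^ n * (v z / (1 - u z)))"
          by (simp add: diff_divide_distrib left_diff_distrib)
        then have "dist ((\<Sum>i<n. u z ^ i) * v z) (v z / (1 - u z)) = norm (u z) ^ n * (norm (v z) / norm (1 - u z))"
          by (simp add: dist_norm norm_mult norm_power norm_divide)
        also have "\<dots> \<le> k ^ n * (M / (1 - k))"
          using u low assms z k M by (intro mult_mono power_mono frac_le) auto
        finally show "dist ((\<Sum>i<n. u z ^ i) * v z) (v z / (1 - u z)) < e" using elim by simp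
      qed
    qed
  qed
qed auto

lemma poly_approximable_power:
  assumes "compact K" "poly_approximable K f"
  shows "poly_approximable K (\<lambda>z. f z ^ n)"
proof (induction n)
  case 0
  show ?case using poly_approximable_cong[OF poly_approximable_poly[of K 1]] by simp
next
  case (Suc n)
  then show ?case using poly_approximable_mult[OF assms] by simp
qed

lemma poly_approximable_sum:
  fixes n :: nat
  assumes "\<And>i. i < n \<Longrightarrow> poly_approximable K (f i)"
  shows "poly_approximable K (\<lambda>z. \<Sum>i<n. f i z)"
  using assms
proof (induction n)
  case 0
  show ?case using poly_approximable_cong[OF poly_approximable_poly[of K 0]] by simp
next
  case (Suc n)
  then show ?case by (simp add: poly_approximable_add)
qed

lemma poly_approximable_geometric:
  assumes K: "compact K" and u: "poly_approximable K u" and v: "poly_approximable K v"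
    and "\<And>z. z \<in> K \<Longrightarrow> norm (u z) \<le> k" "k < 1"
  shows "poly_approximable K (\<lambda>z. v z / (1 - u z))"
proof -
  obtain M where "\<forall>z\<in>K. norm (v z) \<le> M"
    by (rule poly_approximable_bounded[OF K v]) (rule that)
  then have "norm (v z) \<le> M" if "z \<in> K" for z
    using that by blast
  then have "uniform_limit K (\<lambda>n z. (\<Sum>i<n. u z ^ i) * v z) (\<lambda>z. v z / (1 - u z)) sequentially"
    using assms(4,5) by (rule geometric_kernel_uniform_limit[rotated 2])
  then show ?thesis
    by (rule poly_approximable_uniform_limit[rotated])
      (intro poly_approximable_mult poly_approximable_sum poly_approximable_power K u v)
qed

text \<open>With \<open>q = (b - a) / (z - a)\<close> one has
  \<open>1 / (z - b) = (1 / (z - a)) / (1 - q)\<close>, and \<open>q\<close> is at most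
  \<open>norm (b - a) / d < 1\<close> on \<open>K\<close>: a geometric series.\<close>

lemma poly_approximable_push_pole:
  assumes K: "compact K" and a: "poly_approximable K (\<lambda>z. 1 / (z - a))"
    and d: "\<And>z. z \<in> K \<Longrightarrow> d \<le> norm (z - a)" and b: "norm (b - a) < d"
  shows "poly_approximable K (\<lambda>z. 1 / (z - b))"
proof -
  have "d > 0" using b norm_ge_zero[of "b - a"] by linarith
  have "poly_approximable K (\<lambda>z. (1 / (z - a)) / (1 - poly [:b - a:] z * (1 / (z - a))))"
  proof (rule poly_approximable_geometric[OF K _ a, of _ "norm (b - a) / d"])
    show "poly_approximable K (\<lambda>z. poly [:b - a:] z * (1 / (z - a)))"
      by (intro poly_approximable_mult K a poly_approximable_poly)
    show "norm (poly [:b - a:] z * (1 / (z - a))) \<le> norm (b - a) / d" if "z \<in> K" for z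
      using d[OF that] \<open>d > 0\<close> by (simp add: norm_mult norm_divide frac_le)
    show "norm (b - a) / d < 1" using b \<open>d > 0\<close> by simp
  qed
  then show ?thesis
  proof (rule poly_approximable_cong)
    fix z assume "z \<in> K"
    then have "z \<noteq> a" using d \<open>d > 0\<close> by fastforce
    then show "(1 / (z - a)) / (1 - poly [:b - a:] z * (1 / (z - a))) = 1 / (z - b)"
      by (simp add: field_simps)
  qed
qed

text \<open>A pole can be moved a short way in either direction without losing approximability. The
  property is thus locally constant along \<open>L\<close>, hence constant on a connected set that
  misses \<open>K\<close>.\<close>

lemma poly_approximable_pole:
  assumes K: "compact K" and L: "connected L" "L \<inter> K = {}" "a \<in> L" "b \<in> L"
    and a: "poly_approximable K (\<lambda>z. 1 / (z - a))"
  shows "poly_approximable K (\<lambda>z. 1 / (z - b))"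
proof (cases "K = {}")
  case True
  then show ?thesis by (simp add: poly_approximable_def)
next
  case False
  show ?thesis
  proof (rule connected_induction_simple[OF L(1,3,4), where P = "\<lambda>a. poly_approximable K (\<lambda>z. 1 / (z - a))"])
    fix c assume "c \<in> L"
    define d where "d = infdist c K"
    have "c \<notin> K" using L \<open>c \<in> L\<close> by auto
    then have "d > 0"
      using K False by (simp add: d_def compact_imp_closed infdist_pos_not_in_closed)
    have dK: "d \<le> norm (z - c)" if "z \<in> K" for z
      using infdist_le[OF that, of c] by (simp add: d_def dist_norm norm_minus_commute)
    have "poly_approximable K (\<lambda>z. 1 / (z - y))"
      if "x \<in> L \<inter> ball c (d/3)" "y \<in> L \<inter> ball c (d/3)" "poly_approximable K (\<lambda>z. 1 / (z - x))" for x y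
    \<comment> \<open>Two poles within \<open>d/3\<close> of \<open>c\<close> are less than
      \<open>2*d/3\<close> apart, and each is at least \<open>2*d/3\<close> away from
      \<open>K\<close>.\<close>
    proof (rule poly_approximable_push_pole[OF K that(3), of "2*d/3"])
      have x: "norm (x - c) < d/3" and y: "norm (y - c) < d/3"
        using that by (auto simp: dist_norm norm_minus_commute)
      show "2*d/3 \<le> norm (z - x)" if "z \<in> K" for z
        using dK[OF that] x norm_triangle_ineq[of "z - x" "x - c"] by simp
      show "norm (y - x) < 2*d/3"
        using x y norm_triangle_ineq4[of "y - c" "x - c"] by simp
    qed
    then have "\<forall>x\<in>L \<inter> ball c (d/3). \<forall>y\<in>L \<inter> ball c (d/3).
        poly_approximable K (\<lambda>z. 1 / (z - x)) \<longrightarrow> poly_approximable K (\<lambda>z. 1 / (z - y))"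
      by blast
    moreover have "openin (top_of_set L) (L \<inter> ball c (d/3))" "c \<in> L \<inter> ball c (d/3)"
      using \<open>d > 0\<close> \<open>c \<in> L\<close> by (simp_all add: openin_open_Int)
    ultimately show "\<exists>T. openin (top_of_set L) T \<and> c \<in> T \<and> (\<forall>x\<in>T. \<forall>y\<in>T.
        poly_approximable K (\<lambda>z. 1 / (z - x)) \<longrightarrow> poly_approximable K (\<lambda>z. 1 / (z - y)))"
      by blast
  qed (rule a)
qed

text \<open>The starting point for pushing poles: \<open>1 / (z - 2) = (-1/2) / (1 - z/2)\<close> is
  a geometric series on the closed unit disk.\<close>

lemma poly_approximable_pole_2:
  assumes K: "compact K" "K \<subseteq> cball 0 1"
  shows "poly_approximable K (\<lambda>z. 1 / (z - 2))"
proof -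
  have "poly_approximable K (\<lambda>z. poly [:-1/2:] z / (1 - poly [:0, 1/2:] z))"
  proof (rule poly_approximable_geometric[OF K(1) poly_approximable_poly poly_approximable_poly, of _ "1/2"])
    show "norm (poly [:0, 1/2:] z) \<le> 1/2" if "z \<in> K" for z :: complex
      using that K(2) by (auto simp: norm_mult norm_divide)
  qed simp
  then show ?thesis
  proof (rule poly_approximable_cong)
    fix z assume "z \<in> K"
    then have "z \<noteq> 2" using K(2) by auto
    then have "(-1/2) / (1 - z/2) = - (1 / (2 - z))" by (simp add: divide_simps)
    also have "\<dots> = 1 / (z - 2)" by (metis minus_diff_eq minus_divide_right)
    finally show "poly [:-1/2:] z / (1 - poly [:0, 1/2:] z) = 1 / (z - 2)" by simp
  qed
qed

text \<open>The squared norm is \<open>1 - 2 * x * cos s + x\<^sup>2\<close>. Replacing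
  \<open>cos s\<close> by the larger \<open>cos \<delta>\<close> and completing the square leaves at
  least \<open>(sin \<delta>)\<^sup>2\<close>, for every point of the infinite ray.\<close>

lemma norm_one_minus_cis_ge:
  assumes "0 < \<delta>" "\<delta> \<le> 1" "\<delta> \<le> s" "s \<le> 2*pi - \<delta>" "x \<ge> 0"
  shows "sin \<delta> \<le> norm (1 - of_real x * cis s)"
proof -
  have cos: "cos s \<le> cos \<delta>"
  proof (cases "s \<le> pi")
    case True
    then show ?thesis using assms by (intro cos_monotone_0_pi_le) auto
  next
    case False
    then have "cos (2*pi - s) \<le> cos \<delta>" using assms by (intro cos_monotone_0_pi_le) auto
    then show ?thesis by (simp add: cos_diff)
  qed
  have "(sin \<delta>)\<^sup>2 \<le> (x - cos \<delta>)\<^sup>2 + (sin \<delta>)\<^sup>2" by simp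
  also have "\<dots> = 1 - 2 * x * cos \<delta> + x\<^sup>2"
    using sin_cos_squared_add[of \<delta>] by (simp add: power2_diff)
  also have "\<dots> \<le> 1 - 2 * x * cos s + x\<^sup>2"
    using cos assms(5) by (simp add: mult_left_mono)
  also have "\<dots> = (1 - x * cos s)\<^sup>2 + (x * sin s)\<^sup>2"
    by (simp add: power2_diff power_mult_distrib sin_squared_eq algebra_simps)
  also have "\<dots> = (norm (1 - of_real x * cis s))\<^sup>2"
    by (simp add: cmod_power2)
  finally show ?thesis by (rule power2_le_imp_le) simp
qed

text \<open>The function \<open>1 - 1 / (1 - A z)\<close> with \<open>A\<close> large has the properties below except for its
  pole \<open>1 / A\<close>, which is pushed out of the disk along the positive axis. The point is that the
  bound \<open>C\<close> along the radii does not depend on \<open>\<eta>\<close>.\<close>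

lemma polynomial_cutoff:
  assumes "0 < \<delta>" "\<delta> \<le> 1"
  obtains C :: real where "C > 0"
    "\<forall>\<eta>>0. \<exists>e::complex poly. \<forall>s\<in>{\<delta>..2*pi-\<delta>}.
       norm (1 - cis s * poly e (cis s)) \<le> \<eta> \<and>
       (\<forall>r\<in>{0..1}. norm (of_real r * cis s * poly e (of_real r * cis s)) \<le> C)"
proof -
  have sin: "sin \<delta> > 0" using assms pi_gt3 by (intro sin_gt_zero) auto
  \<comment> \<open>The closed unit disk with a sector around the positive axis removed; the pole
    travels through that sector.\<close>
  define K where "K = (\<lambda>(r,s). complex_of_real r * cis s) ` ({0..1} \<times> {\<delta>..2*pi-\<delta>})"
  have K: "compact K" unfolding K_def case_prod_unfold
    by (intro compact_continuous_image compact_Times continuous_intros) auto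
  have K1: "K \<subseteq> cball 0 1" by (auto simp: K_def norm_mult)
  \<comment> \<open>\<open>1 / sin \<delta>\<close> bounds the function \<open>1 / (1 - A z)\<close>
    along the radii; \<open>4\<close> absorbs the constant \<open>1\<close> and two errors of size
    \<open>\<eta>/3\<close>.\<close>
  show ?thesis
  proof (rule that[of "4 + 1 / sin \<delta>"])
    show "4 + 1 / sin \<delta> > 0" using sin by (simp add: add_pos_pos)
  next
    show "\<forall>\<eta>>0. \<exists>e::complex poly. \<forall>s\<in>{\<delta>..2*pi-\<delta>}.
       norm (1 - cis s * poly e (cis s)) \<le> \<eta> \<and>
       (\<forall>r\<in>{0..1}. norm (of_real r * cis s * poly e (of_real r * cis s)) \<le> 4 + 1 / sin \<delta>)"
    proof (intro allI impI)
      fix \<eta>' :: real assume "\<eta>' > 0"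
      \<comment> \<open>Capping by \<open>1\<close> bounds the errors in the radial estimate by a
        fixed number, as the independence of \<open>C\<close> from the accuracy requires.\<close>
      define \<eta> where "\<eta> = min 1 \<eta>'"
      have \<eta>: "\<eta> > 0" "\<eta> \<le> 1" "\<eta> \<le> \<eta>'" using \<open>\<eta>' > 0\<close> by (auto simp: \<eta>_def)
      \<comment> \<open>This makes \<open>1 / (A - 1) = \<eta>/3\<close>, which bounds
        \<open>1 / (1 - A z)\<close> on the unit circle.\<close>
      define A where "A = 1 + 3 / \<eta>"
      have A: "A > 1" using \<eta> by (simp add: A_def)
      define L where "L = complex_of_real ` {1/A..2}"
      have "connected L" unfolding L_def
        by (intro connected_continuous_image continuous_intros) auto
      have "1 / A < 1" using A by simp
      then have "2 \<in> L" "of_real (1/A) \<in> L"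
        unfolding L_def by (force intro: image_eqI[of _ _ 2], force)
      have "L \<inter> K = {}"
      proof (rule ccontr)
        assume "L \<inter> K \<noteq> {}"
        then obtain x r s where x: "1/A \<le> x" and r: "0 \<le> r" and s: "\<delta> \<le> s" "s \<le> 2*pi-\<delta>"
          and eq: "complex_of_real x = complex_of_real r * cis s"
          by (auto simp: L_def K_def)
        have "x > 0" using x A by (meson divide_pos_pos less_le_trans less_trans zero_less_one)
        then have "of_real (r/x) * cis s = 1" using eq[symmetric] by simp
        then have "1 - of_real (r/x) * cis s = 0" by simp
        moreover have "sin \<delta> \<le> norm (1 - of_real (r/x) * cis s)"
          using assms s r \<open>x > 0\<close> by (intro norm_one_minus_cis_ge) auto
        ultimately show False using sin by simp
      qed
      have "poly_approximable K (\<lambda>z. 1 / (z - of_real (1/A)))"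
        using poly_approximable_pole[OF K \<open>connected L\<close> \<open>L \<inter> K = {}\<close> \<open>2 \<in> L\<close> \<open>of_real (1/A) \<in> L\<close>]
          poly_approximable_pole_2[OF K K1] by blast
      then have "poly_approximable K (\<lambda>z. poly [:- of_real (1/A):] z * (1 / (z - of_real (1/A))))"
        by (intro poly_approximable_mult K poly_approximable_poly)
      then have "poly_approximable K (\<lambda>z. 1 / (1 - of_real A * z))"
      proof (rule poly_approximable_cong)
        fix z assume "z \<in> K"
        then have "z \<noteq> of_real (1/A)" using \<open>L \<inter> K = {}\<close> \<open>of_real (1/A) \<in> L\<close> by auto
        then have "1 - of_real A * z \<noteq> 0" using A by (auto simp: field_simps)
        then show "poly [:- of_real (1/A):] z * (1 / (z - of_real (1/A))) = 1 / (1 - of_real A * z)"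
          using A \<open>z \<noteq> of_real (1/A)\<close> by (simp add: field_simps)
      qed
      then obtain p where p: "\<And>z. z \<in> K \<Longrightarrow> norm (1 / (1 - of_real A * z) - poly p z) < \<eta>/3"
        unfolding poly_approximable_def using \<eta> by (metis divide_pos_pos zero_less_numeral)
      \<comment> \<open>The approximated function is \<open>1\<close> at \<open>0\<close>, so the
        constant term \<open>c\<close> of \<open>p\<close> is close to \<open>1\<close>. Hence
        \<open>z * poly (- e) z = c - poly p z\<close> is close to \<open>1 - 1 / (1 - A z)\<close>
        and vanishes at \<open>0\<close>.\<close>
      obtain c e where pc: "p = pCons c e" by (metis pCons_cases)
      have "of_real 0 * cis 1 \<in> K"
        unfolding K_def using assms pi_gt3 by (intro image_eqI[of _ _ "(0,1)"]) auto
      from p[OF this] have c: "norm (1 - c) < \<eta>/3" by (simp add: pc)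
      show "\<exists>e::complex poly. \<forall>s\<in>{\<delta>..2*pi-\<delta>}.
         norm (1 - cis s * poly e (cis s)) \<le> \<eta>' \<and>
         (\<forall>r\<in>{0..1}. norm (of_real r * cis s * poly e (of_real r * cis s)) \<le> 4 + 1 / sin \<delta>)"
      proof (intro exI[of _ "- e"] ballI conjI)
        fix s assume s: "s \<in> {\<delta>..2*pi-\<delta>}"
        have inK: "of_real r * cis s \<in> K" if "r \<in> {0..1}" for r
          unfolding K_def using s that by (intro image_eqI[of _ _ "(r,s)"]) auto
        have cis: "cis s \<in> K" using inK[of 1] by simp
        define u where "u = 1 / (1 - of_real A * cis s)"
        have "A - 1 \<le> norm (1 - of_real A * cis s)"
          using norm_triangle_ineq2[of "of_real A * cis s" 1] A by (simp add: norm_mult norm_minus_commute)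
        then have "norm u \<le> 1 / (A - 1)"
          using A by (simp add: u_def norm_divide frac_le)
        then have u: "norm u \<le> \<eta>/3" by (simp add: A_def)
        have pu: "norm (u - poly p (cis s)) < \<eta>/3" using p[OF cis] by (simp only: u_def)
        have "1 - cis s * poly (- e) (cis s) = u - (u - poly p (cis s)) + (1 - c)"
          by (simp add: pc)
        also have "norm \<dots> \<le> norm u + norm (u - poly p (cis s)) + norm (1 - c)"
          by (meson add_right_mono norm_triangle_ineq norm_triangle_ineq4 order_trans)
        finally show "norm (1 - cis s * poly (- e) (cis s)) \<le> \<eta>'"
          using u pu c \<eta> by linarith
        fix r :: real assume r: "r \<in> {0..1}"
        define z where "z = of_real r * cis s"
        have z: "z \<in> K" using inK[OF r] by (simp add: z_def)
        define v where "v = 1 / (1 - of_real A * z)"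
        have "sin \<delta> \<le> norm (1 - of_real (A * r) * cis s)"
          using s r A assms by (intro norm_one_minus_cis_ge) auto
        then have v: "norm v \<le> 1 / sin \<delta>"
          using sin by (simp add: v_def norm_divide frac_le z_def mult.assoc)
        have pv: "norm (v - poly p z) < \<eta>/3" using p[OF z] by (simp only: v_def)
        have "z * poly (- e) z = (v - poly p z) - v + 1 - (1 - c)"
          by (simp add: pc)
        then have "norm (z * poly (- e) z) \<le> norm (v - poly p z) + norm v + 1 + norm (1 - c)"
          using norm_triangle_ineq4[of "v - poly p z" v] norm_triangle_ineq[of "v - poly p z - v" 1]
            norm_triangle_ineq4[of "v - poly p z - v + 1" "1 - c"]
          by (simp del: poly_minus mult_minus_right)
        then have "norm (z * poly (- e) z) \<le> 4 + 1 / sin \<delta>"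
          using pv v c \<eta> by linarith
        then show "norm (of_real r * cis s * poly (- e) (of_real r * cis s)) \<le> 4 + 1 / sin \<delta>"
          by (simp add: z_def)
      qed
    qed
  qed
qed

section \<open>Polynomials close to a measurable function on the circle\<close>

text \<open>On the unit circle \<open>cnj z = 1 / z\<close>, so a polynomial in the real and
  imaginary parts is a Laurent polynomial there. The factor \<open>z ^ K\<close> clears its
  denominator.\<close>

lemma laurent_of_real_polynomial_function:
  fixes f :: "complex \<Rightarrow> real"
  assumes "real_polynomial_function f"
  shows "\<exists>q K. \<forall>z. norm z = 1 \<longrightarrow> of_real (f z) * z ^ K = poly q z"
  using assms
proof (induction f rule: real_polynomial_function.induct)
  case (linear f)
  interpret bounded_linear f by fact
  have "of_real (f z) * z ^ 1 = poly [:of_real (f 1) / 2 - of_real (f \<i>) / (2*\<i>), 0,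
      of_real (f 1) / 2 + of_real (f \<i>) / (2*\<i>):] z" if "norm z = 1" for z
  proof -
    have zz: "z * cnj z = 1"
      using that by (simp add: complex_norm_square[symmetric])
    have "f z = f (Re z *\<^sub>R 1 + Im z *\<^sub>R \<i>)"
      by (rule arg_cong[of _ _ f]) (simp add: complex_eq_iff)
    also have "\<dots> = Re z * f 1 + Im z * f \<i>"
      by (simp only: add scale) simp
    finally have "complex_of_real (f z) = of_real (Re z) * of_real (f 1) + of_real (Im z) * of_real (f \<i>)"
      by simp
    moreover have "of_real (Re z) = (z + cnj z) / 2" "of_real (Im z) = (z - cnj z) / (2*\<i>)"
      by (simp_all add: complex_eq_iff Re_divide Im_divide)
    ultimately have fz: "complex_of_real (f z)
        = (z + cnj z) / 2 * of_real (f 1) + (z - cnj z) / (2*\<i>) * of_real (f \<i>)"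
      by simp
    have "complex_of_real (f z) * z
        = (z * z + z * cnj z) / 2 * of_real (f 1) + (z * z - z * cnj z) / (2*\<i>) * of_real (f \<i>)"
      unfolding fz by (simp add: algebra_simps add_divide_distrib diff_divide_distrib)
    also have "\<dots> = (z * z + 1) / 2 * of_real (f 1) + (z * z - 1) / (2*\<i>) * of_real (f \<i>)"
      unfolding zz ..
    finally show ?thesis
      by (simp add: algebra_simps add_divide_distrib diff_divide_distrib)
  qed
  then show ?case by blast
next
  case (const c)
  show ?case by (rule exI[of _ "[:of_real c:]"], rule exI[of _ 0]) simp
next
  case (add f g)
  then obtain q1 K1 q2 K2 where q1: "\<And>z. norm z = 1 \<Longrightarrow> of_real (f z) * z ^ K1 = poly q1 z"
    and q2: "\<And>z. norm z = 1 \<Longrightarrow> of_real (g z) * z ^ K2 = poly q2 z" by blast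
  have "of_real (f z + g z) * z ^ (K1 + K2) = poly (q1 * monom 1 K2 + q2 * monom 1 K1) z"
    if "norm z = 1" for z
    by (simp add: poly_monom q1[OF that, symmetric] q2[OF that, symmetric] power_add algebra_simps)
  then show ?case by blast
next
  case (mult f g)
  then obtain q1 K1 q2 K2 where q1: "\<And>z. norm z = 1 \<Longrightarrow> of_real (f z) * z ^ K1 = poly q1 z"
    and q2: "\<And>z. norm z = 1 \<Longrightarrow> of_real (g z) * z ^ K2 = poly q2 z" by blast
  have "of_real (f z * g z) * z ^ (K1 + K2) = poly (q1 * q2) z" if "norm z = 1" for z
    by (simp add: q1[OF that, symmetric] q2[OF that, symmetric] power_add)
  then show ?case by blast
qed

lemma laurent_of_polynomial_function:
  fixes f :: "complex \<Rightarrow> complex"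
  assumes "polynomial_function f"
  obtains q K where "\<And>z. norm z = 1 \<Longrightarrow> f z = poly q z / z ^ K"
proof -
  have "real_polynomial_function (Re \<circ> f)" "real_polynomial_function (Im \<circ> f)"
    using assms bounded_linear_Re bounded_linear_Im unfolding polynomial_function_def by blast+
  then obtain q1 K1 q2 K2 where q1: "\<And>z. norm z = 1 \<Longrightarrow> of_real (Re (f z)) * z ^ K1 = poly q1 z"
    and q2: "\<And>z. norm z = 1 \<Longrightarrow> of_real (Im (f z)) * z ^ K2 = poly q2 z"
    by (metis comp_apply laurent_of_real_polynomial_function)
  have "f z = poly (q1 * monom 1 K2 + smult \<i> (q2 * monom 1 K1)) z / z ^ (K1 + K2)"
    if "norm z = 1" for z
  proof -
    have "z \<noteq> 0" using that by auto
    have "poly (q1 * monom 1 K2 + smult \<i> (q2 * monom 1 K1)) z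
        = (of_real (Re (f z)) + \<i> * of_real (Im (f z))) * z ^ (K1 + K2)"
      by (simp add: poly_monom q1[OF that, symmetric] q2[OF that, symmetric] power_add algebra_simps)
    then show ?thesis using \<open>z \<noteq> 0\<close> by (simp add: complex_eq[symmetric])
  qed
  then show ?thesis by (rule that)
qed

section \<open>Approximation of measurable functions off a set of small measure\<close>

text \<open>The argument of Egorov's theorem: a measurable function is almost everywhere a limit of
  continuous ones, and on a set of finite measure the set where the tail of the sequence fails the
  tolerance shrinks to measure zero.\<close>

lemma measurable_approx_continuous:
  fixes R :: "real \<Rightarrow> complex"
  assumes R: "R \<in> borel_measurable (lebesgue_on S)" and S: "S \<in> lmeasurable" and "\<epsilon> > 0" "\<delta> > 0"
  obtains g B where "continuous_on UNIV g" "B \<in> lmeasurable" "measure lebesgue B \<le> \<delta>"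
    "\<And>t. t \<in> S - B \<Longrightarrow> norm (R t - g t) < \<epsilon>"
proof -
  have S': "S \<in> sets lebesgue" using S by auto
  interpret M: finite_measure "lebesgue_on S" by (rule finite_measure_lebesgue_on[OF S])
  have "R measurable_on S"
    using R S' by (simp add: measurable_on_iff_borel_measurable)
  then obtain N g where N: "negligible N" and g: "\<And>n. continuous_on UNIV (g n)"
    and lim: "\<And>t. t \<notin> N \<Longrightarrow> (\<lambda>n. g n t) \<longlonglongrightarrow> (if t \<in> S then R t else 0)"
    unfolding measurable_on_def by blast
  have gm: "g n \<in> borel_measurable (lebesgue_on S)" for n
    using g[of n] by (simp add: continuous_imp_measurable_on_sets_lebesgue S' continuous_on_subset)
  define A where "A k = {t \<in> space (lebesgue_on S). norm (R t - g k t) \<ge> \<epsilon>}" for k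
  \<comment> \<open>The points at which some approximant with index at least \<open>n\<close> is
    still off by \<open>\<epsilon>\<close>. These sets decrease, and their intersection lies in the
    null set \<open>N\<close>.\<close>
  define C where "C n = (\<Union>k\<in>{n..}. A k)" for n
  have A: "A k \<in> sets (lebesgue_on S)" for k
    unfolding A_def using R gm[of k] by measurable
  have C: "C n \<in> sets (lebesgue_on S)" for n
    unfolding C_def using A by auto
  have "decseq C" unfolding C_def decseq_def by fastforce
  have "(\<Inter>n. C n) \<subseteq> N"
  proof
    fix t assume t: "t \<in> (\<Inter>n. C n)"
    then have "t \<in> S" by (auto simp: C_def A_def)
    show "t \<in> N"
    proof (rule ccontr)
      assume "t \<notin> N"
      then have "(\<lambda>n. g n t) \<longlonglongrightarrow> R t" using lim[of t] \<open>t \<in> S\<close> by simp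
      then obtain n where n: "\<And>k. k \<ge> n \<Longrightarrow> norm (g k t - R t) < \<epsilon>"
        using LIMSEQ_D \<open>\<epsilon> > 0\<close> by metis
      have "t \<in> C n" using t by blast
      then obtain k where "k \<ge> n" "norm (R t - g k t) \<ge> \<epsilon>" by (auto simp: C_def A_def)
      then show False using n[of k] by (simp add: norm_minus_commute)
    qed
  qed
  then have null: "measure lebesgue (\<Inter>n. C n) = 0"
    by (meson negligible_subset N negligible_imp_measure0)
  have inter: "(\<Inter>n. C n) \<subseteq> S" by (auto simp: C_def A_def)
  have "(\<lambda>n. measure (lebesgue_on S) (C n)) \<longlonglongrightarrow> measure (lebesgue_on S) (\<Inter>n. C n)"
    using C \<open>decseq C\<close> by (intro M.finite_Lim_measure_decseq) auto
  then have "(\<lambda>n. measure (lebesgue_on S) (C n)) \<longlonglongrightarrow> 0"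
    using null inter S' by (simp add: measure_restrict_space)
  then obtain n where n: "measure (lebesgue_on S) (C n) < \<delta>"
    using \<open>\<delta> > 0\<close> by (metis (no_types, lifting) order_tendstoD(2) eventually_sequentially le_refl)
  have CS: "C n \<subseteq> S" by (auto simp: C_def A_def)
  show ?thesis
  proof (rule that[of "g n" "C n"])
    have Cn: "C n \<in> sets lebesgue"
      using C[of n] S' by (simp add: sets_restrict_space_iff)
    show "C n \<in> lmeasurable"
      using S CS Cn by (rule fmeasurableI2)
    show "measure lebesgue (C n) \<le> \<delta>"
      using n CS S' by (simp add: measure_restrict_space)
    show "norm (R t - g n t) < \<epsilon>" if "t \<in> S - C n" for t
      using that by (force simp: C_def A_def)
  qed (rule g)
qed

text \<open>Cutting out a small arc around \<open>1\<close> makes \<open>Arg2pi\<close> continuous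
  on the remaining compact arc. The continuous approximant can then be carried to the circle, where
  Stone-Weierstrass yields a polynomial function, that is, a Laurent polynomial.\<close>

lemma measurable_approx_laurent:
  fixes R :: "real \<Rightarrow> complex"
  assumes R: "R \<in> borel_measurable (lebesgue_on {0..2*pi})" and "\<epsilon> > 0" "\<delta> > 0"
  obtains B q K where "B \<in> lmeasurable" "measure lebesgue B \<le> \<delta>"
    "\<forall>t\<in>{0..2*pi} - B. norm (R t - poly q (cis t) / cis t ^ K) < \<epsilon>"
proof -
  obtain g B where g: "continuous_on UNIV g" and B: "B \<in> lmeasurable" "measure lebesgue B \<le> \<delta>/2"
    and gB: "\<And>t. t \<in> {0..2*pi} - B \<Longrightarrow> norm (R t - g t) < \<epsilon>/2"
    using measurable_approx_continuous[OF R, of "\<epsilon>/2" "\<delta>/2"] assms by auto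
  \<comment> \<open>The two end intervals of length \<open>a\<close> have total measure at most
    \<open>\<delta>/2\<close>, the share left over by \<open>B\<close>.\<close>
  define a where "a = min (\<delta>/4) 1"
  have a: "0 < a" "a \<le> 1" "a \<le> \<delta>/4" using assms by (auto simp: a_def)
  define S where "S = cis ` {a..2*pi-a}"
  have "compact S" unfolding S_def by (intro compact_continuous_image continuous_intros) auto
  have arg: "Arg2pi (cis t) = t" if "0 \<le> t" "t < 2*pi" for t
    using that by (intro Arg2pi_unique[of 1]) (auto simp: cis_conv_exp)
  have "continuous_on S (\<lambda>z. g (Arg2pi z))"
  proof (rule continuous_on_compose2[OF g])
    show "continuous_on S Arg2pi"
    proof (intro continuous_at_imp_continuous_on ballI continuous_at_Arg2pi)
      fix z assume "z \<in> S"
      then obtain t where t: "z = cis t" "a \<le> t" "t \<le> 2*pi-a" by (auto simp: S_def)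
      then have "Arg2pi z \<noteq> 0" using a arg[of t] by auto
      then show "z \<notin> \<real>\<^sub>\<ge>\<^sub>0" by (auto simp: Arg2pi_eq_0 complex_nonneg_Reals_iff complex_is_Real_iff)
    qed
  qed auto
  then obtain f where f: "polynomial_function f" "\<And>z. z \<in> S \<Longrightarrow> norm (g (Arg2pi z) - f z) < \<epsilon>/2"
    using Stone_Weierstrass_polynomial_function[OF \<open>compact S\<close>, of "\<lambda>z. g (Arg2pi z)" "\<epsilon>/2"] \<open>\<epsilon> > 0\<close> by auto
  obtain q K where q: "\<And>z. norm z = 1 \<Longrightarrow> f z = poly q z / z ^ K"
    using laurent_of_polynomial_function[OF f(1)] by blast
  define B' where "B' = B \<union> ({0..a} \<union> {2*pi-a..2*pi})"
  show ?thesis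
  proof (rule that[of B' q K])
    show "B' \<in> lmeasurable" unfolding B'_def using B by (intro fmeasurable.Un) auto
    have "measure lebesgue B' \<le> measure lebesgue B + measure lebesgue ({0..a} \<union> {2*pi-a..2*pi})"
      unfolding B'_def using B by (intro measure_Un_le) auto
    also have "measure lebesgue ({0..a} \<union> {2*pi-a..2*pi}) \<le> measure lebesgue {0..a} + measure lebesgue {2*pi-a..2*pi}"
      by (intro measure_Un_le) auto
    also have "\<dots> = 2 * a" using a by simp
    finally show "measure lebesgue B' \<le> \<delta>" using B a by simp
    show "\<forall>t\<in>{0..2*pi} - B'. norm (R t - poly q (cis t) / cis t ^ K) < \<epsilon>"
    proof
      fix t assume t: "t \<in> {0..2*pi} - B'"
      then have "a \<le> t" "t \<le> 2*pi-a" "t \<notin> B" by (auto simp: B'_def)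
      then have "norm (g t - f (cis t)) < \<epsilon>/2"
        using f(2)[of "cis t"] arg[of t] a by (auto simp: S_def)
      moreover have "norm (R t - g t) < \<epsilon>/2" using gB t \<open>t \<notin> B\<close> by auto
      ultimately have "norm (R t - f (cis t)) < \<epsilon>"
        using norm_triangle_lt[of "R t - g t" "g t - f (cis t)" \<epsilon>] by simp
      then show "norm (R t - poly q (cis t) / cis t ^ K) < \<epsilon>" using q[of "cis t"] by simp
    qed
  qed
qed

text \<open>The bad angles lie within \<open>\<delta> / m\<close> of one of the \<open>m + 1\<close>
  points \<open>2*pi*k / m\<close>. Their measure is at most
  \<open>(m + 1) * 2 * \<delta> / m\<close>, which is bounded independently of
  \<open>m\<close>.\<close>

lemma multiple_angle_avoids_zero:
  assumes "m \<ge> (1::nat)" "0 < \<delta>"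
  obtains B where "B \<in> lmeasurable" "measure lebesgue B \<le> 4 * \<delta>"
    "\<forall>t\<in>{0..2*pi} - B. \<exists>s\<in>{\<delta>..2*pi-\<delta>}. cis (real m * t) = cis s"
proof -
  define J where "J k = {(2*pi * real k - \<delta>) / m .. (2*pi * real k + \<delta>) / m}" for k
  define B where "B = (\<Union>k\<in>{..m}. J k)"
  have J: "measure lebesgue (J k) = 2 * \<delta> / m" for k
    unfolding J_def using assms by (simp add: field_simps)
  show ?thesis
  proof (rule that[of B])
    show "B \<in> lmeasurable" unfolding B_def J_def by (intro fmeasurable.finite_UN) auto
    have "measure lebesgue B \<le> (\<Sum>k\<in>{..m}. measure lebesgue (J k))"
      unfolding B_def by (intro measure_UNION_le) (auto simp: J_def)
    also have "\<dots> = (1 + real m) * (2 * \<delta>) / m" by (simp add: J)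
    also have "\<dots> \<le> (2 * real m) * (2 * \<delta>) / m"
      using assms by (intro divide_right_mono mult_right_mono) auto
    finally show "measure lebesgue B \<le> 4 * \<delta>" using assms by simp
    show "\<forall>t\<in>{0..2*pi} - B. \<exists>s\<in>{\<delta>..2*pi-\<delta>}. cis (real m * t) = cis s"
    proof
      fix t assume t: "t \<in> {0..2*pi} - B"
      define k where "k = nat \<lfloor>m * t / (2*pi)\<rfloor>"
      have "0 \<le> m * t / (2*pi)" using t by simp
      then have k: "real k \<le> m * t / (2*pi)" "m * t / (2*pi) < real k + 1"
        unfolding k_def by (auto simp: of_nat_nat)
      define s where "s = m * t - 2*pi * real k"
      have s: "0 \<le> s" "s < 2*pi" using k by (auto simp: s_def field_simps)
      have "real k \<le> m"
      proof -
        have "m * t / (2*pi) \<le> m" using t assms by (simp add: field_simps mult_left_mono)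
        then show ?thesis using k by linarith
      qed
      then have km: "k \<le> m" by simp
      have 1: "\<delta> < s"
      proof (rule ccontr)
        assume "\<not> \<delta> < s"
        then have "t \<in> J k" using s assms by (auto simp: J_def s_def field_simps)
        then show False using km t by (auto simp: B_def)
      qed
      have 2: "s < 2*pi - \<delta>"
      proof (rule ccontr)
        assume "\<not> s < 2*pi - \<delta>"
        then have "t \<in> J (Suc k)" using s assms by (auto simp: J_def s_def field_simps)
        \<comment> \<open>Only \<open>k = m\<close> remains, and then
          \<open>m * t \<le> 2*pi*m\<close> forces \<open>s \<le> 0\<close>, against the bound
          already proved.\<close>
        then have "\<not> Suc k \<le> m" using t by (auto simp: B_def)
        then have "k = m" using km by simp
        moreover have "m * t \<le> m * (2*pi)" using t by (intro mult_left_mono) auto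
        ultimately have "s \<le> 0" by (simp add: s_def mult.commute)
        then show False using 1 assms by simp
      qed
      have "cis (real m * t) = cis s * cis (2*pi * real k)" by (simp add: s_def cis_mult del: cis_multiple_2pi)
      also have "cis (2*pi * real k) = 1" by (rule cis_multiple_2pi) auto
      finally show "\<exists>s\<in>{\<delta>..2*pi-\<delta>}. cis (real m * t) = cis s" using 1 2 by auto
    qed
  qed
qed

text \<open>The approximant is \<open>e (z ^ m) * T z\<close> with a Laurent polynomial \<open>T\<close> close to \<open>R\<close> on most of the
  circle and a cutoff \<open>e\<close> vanishing at \<open>0\<close>: for large \<open>m\<close> it is a polynomial, it is small away
  from the circle, and the exceptional angles of \<open>e (z ^ m)\<close> have the same small measure as those of \<open>e\<close>.\<close>

lemma radial_approximation_step:
  assumes "0 < \<delta>" "\<delta> \<le> 1"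
  obtains C :: real where "C > 0"
    "\<forall>R \<epsilon> \<rho>. R \<in> borel_measurable (lebesgue_on {0..2*pi}) \<longrightarrow> 0 < \<epsilon> \<longrightarrow> \<rho> < 1 \<longrightarrow>
      (\<exists>p B. B \<in> lmeasurable \<and> measure lebesgue B \<le> 5 * \<delta> \<and>
        (\<forall>z\<in>cball 0 \<rho>. norm (poly p z) \<le> \<epsilon>) \<and>
        (\<forall>t\<in>{0..2*pi} - B. norm (R t - poly p (cis t)) \<le> \<epsilon> \<and>
           (\<forall>r\<in>{0..1}. norm (poly p (of_real r * cis t)) \<le> C * (norm (R t) + \<epsilon>) + \<epsilon>)))"
proof -
  obtain C :: real where C: "C > 0" and cutoff: "\<forall>\<eta>>0. \<exists>e::complex poly. \<forall>s\<in>{\<delta>..2*pi-\<delta>}.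
       norm (1 - cis s * poly e (cis s)) \<le> \<eta> \<and>
       (\<forall>r\<in>{0..1}. norm (of_real r * cis s * poly e (of_real r * cis s)) \<le> C)"
    by (rule polynomial_cutoff[OF assms]) (rule that)
  show ?thesis
  proof (rule that[OF C], intro allI impI)
    fix R :: "real \<Rightarrow> complex" and \<epsilon> \<rho> :: real
    assume R: "R \<in> borel_measurable (lebesgue_on {0..2*pi})" and \<epsilon>: "0 < \<epsilon>" and \<rho>: "\<rho> < 1"
    obtain B1 q K where B1: "B1 \<in> lmeasurable" "measure lebesgue B1 \<le> \<delta>"
      and qR: "\<forall>t\<in>{0..2*pi} - B1. norm (R t - poly q (cis t) / cis t ^ K) < \<epsilon>/2"
      by (rule measurable_approx_laurent[OF R half_gt_zero[OF \<epsilon>] assms(1)]) (rule that)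
    define T where "T z = poly q z / z ^ K" for z
    \<comment> \<open>On this annulus \<open>T\<close> has no pole, so it is uniformly continuous
      and its values near the circle are close to those on it.\<close>
    define X :: "complex set" where "X = cball 0 1 - ball 0 (1/2)"
    have "compact X" unfolding X_def by (intro compact_diff) auto
    moreover have "continuous_on X T"
      unfolding T_def by (intro continuous_intros) (auto simp: X_def)
    ultimately have uc: "uniformly_continuous_on X T" by (rule compact_uniformly_continuous[rotated])
    obtain d where d: "d > 0" "\<forall>z\<in>X. \<forall>w\<in>X. dist w z < d \<longrightarrow> dist (T w) (T z) < \<epsilon>/2"
      using uc[unfolded uniformly_continuous_on_def, THEN spec, THEN mp, OF half_gt_zero[OF \<epsilon>]] by blast
    \<comment> \<open>Below radius \<open>\<sigma>\<close> the polynomial itself will be small.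
      Above it, \<open>T\<close> differs from its value at the end of the radius by less than
      \<open>\<epsilon>/2\<close>.\<close>
    define \<sigma> where "\<sigma> = max (max \<rho> (1/2)) (1 - d/2)"
    have \<sigma>: "\<rho> \<le> \<sigma>" "1/2 \<le> \<sigma>" "1 - d/2 \<le> \<sigma>" "\<sigma> < 1" using d(1) \<rho> unfolding \<sigma>_def by linarith+
    obtain Q where Q: "Q > 0" "\<forall>z\<in>cball 0 1. norm (poly q z) \<le> Q"
      by (rule poly_approximable_bounded[OF compact_cball poly_approximable_poly]) (rule that)
    have TQ: "norm (T (cis t)) \<le> Q" for t
      using Q(2)[THEN bspec, of "cis t"] by (simp add: T_def norm_divide norm_power)
    \<comment> \<open>The error of the cutoff is multiplied by \<open>T\<close>, which is bounded by
      \<open>Q\<close> on the circle.\<close>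
    have "\<epsilon>/(2*Q) > 0" using \<epsilon> Q(1) by simp
    with cutoff obtain e where e0: "\<forall>s\<in>{\<delta>..2*pi-\<delta>}. norm (1 - cis s * poly e (cis s)) \<le> \<epsilon>/(2*Q) \<and>
       (\<forall>r\<in>{0..1}. norm (of_real r * cis s * poly e (of_real r * cis s)) \<le> C)"
      by meson
    have e: "\<And>s. s \<in> {\<delta>..2*pi-\<delta>} \<Longrightarrow> norm (1 - cis s * poly e (cis s)) \<le> \<epsilon>/(2*Q)"
       "\<And>s r. s \<in> {\<delta>..2*pi-\<delta>} \<Longrightarrow> r \<in> {0..1} \<Longrightarrow> norm (of_real r * cis s * poly e (of_real r * cis s)) \<le> C"
      using e0 by blast+
    obtain E where E: "E > 0" "\<forall>z\<in>cball 0 1. norm (poly e z) \<le> E"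
      by (rule poly_approximable_bounded[OF compact_cball poly_approximable_poly]) (rule that)
    obtain j where j: "\<sigma> ^ j < \<epsilon> / (E * Q)"
      using real_arch_pow_inv[of "\<epsilon> / (E * Q)" \<sigma>] \<epsilon> E(1) Q(1) \<sigma> by auto
    \<comment> \<open>\<open>K\<close> of the \<open>m\<close> factors \<open>z\<close> cancel the
      pole of \<open>T\<close> at \<open>0\<close>; the other \<open>Suc j\<close> make the product
      small for \<open>norm z \<le> \<sigma>\<close>. The cutoff in use is
      \<open>z * poly e z\<close>.\<close>
    define m where "m = Suc j + K"
    define p where "p = monom 1 (Suc j) * (e \<circ>\<^sub>p monom 1 m) * q"
    have p: "poly p z = z ^ Suc j * poly e (z ^ m) * poly q z" for z
      by (simp add: p_def poly_pcompose poly_monom)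
    have pT: "poly p z = (z ^ m * poly e (z ^ m)) * T z" if "z \<noteq> 0" for z
    proof -
      have zm: "z ^ m = z ^ Suc j * z ^ K" unfolding m_def by (rule power_add)
      have zT: "poly q z = z ^ K * T z" using that by (simp add: T_def)
      have "(z ^ m * c) * T z = z ^ Suc j * c * poly q z" for c
        unfolding zm zT by (simp only: mult_ac)
      from this[of "poly e (z ^ m)"] show ?thesis unfolding p by (rule sym)
    qed
    have small: "norm (poly p z) \<le> \<epsilon>" if "norm z \<le> \<sigma>" for z
    proof -
      have z: "norm z \<le> 1" using that \<sigma> by simp
      have "norm (poly p z) = norm z ^ Suc j * norm (poly e (z ^ m)) * norm (poly q z)"
        by (simp add: p norm_mult norm_power)
      also have "\<dots> \<le> \<sigma> ^ j * E * Q"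
      proof (intro mult_mono)
        have "norm z ^ Suc j \<le> norm z ^ j" using z by (simp add: mult_left_le_one_le)
        also have "\<dots> \<le> \<sigma> ^ j" using that by (intro power_mono) auto
        finally show "norm z ^ Suc j \<le> \<sigma> ^ j" .
        show "norm (poly e (z ^ m)) \<le> E" using z by (intro E(2)[rule_format]) (simp add: norm_power power_le_one)
        show "norm (poly q z) \<le> Q" using z by (intro Q(2)[rule_format]) simp
      qed (use \<sigma> E(1) in auto)
      also have "\<dots> \<le> \<epsilon>"
      proof -
        have "\<sigma> ^ j * (E * Q) < \<epsilon>" using j E(1) Q(1) by (simp only: pos_less_divide_eq mult_pos_pos)
        then show ?thesis by (simp only: mult.assoc)
      qed
      finally show ?thesis .
    qed
    have m1: "m \<ge> 1" by (simp add: m_def)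
    obtain B2 where B2: "B2 \<in> lmeasurable" "measure lebesgue B2 \<le> 4 * \<delta>"
      and angle: "\<forall>t\<in>{0..2*pi} - B2. \<exists>s\<in>{\<delta>..2*pi-\<delta>}. cis (real m * t) = cis s"
      by (rule multiple_angle_avoids_zero[OF m1 assms(1)]) (rule that)
    show "\<exists>p B. B \<in> lmeasurable \<and> measure lebesgue B \<le> 5 * \<delta> \<and>
        (\<forall>z\<in>cball 0 \<rho>. norm (poly p z) \<le> \<epsilon>) \<and>
        (\<forall>t\<in>{0..2*pi} - B. norm (R t - poly p (cis t)) \<le> \<epsilon> \<and>
           (\<forall>r\<in>{0..1}. norm (poly p (of_real r * cis t)) \<le> C * (norm (R t) + \<epsilon>) + \<epsilon>))"
    proof (intro exI[of _ p] exI[of _ "B1 \<union> B2"] conjI ballI)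
      show "B1 \<union> B2 \<in> lmeasurable" using B1 B2 by (intro fmeasurable.Un) auto
      show "measure lebesgue (B1 \<union> B2) \<le> 5 * \<delta>"
        using B1 B2 measure_Un_le[of B1 lebesgue B2] by (simp add: fmeasurableD)
      show "norm (poly p z) \<le> \<epsilon>" if "z \<in> cball 0 \<rho>" for z
        using that \<sigma> by (intro small) auto
      fix t assume t: "t \<in> {0..2*pi} - (B1 \<union> B2)"
      obtain s where s: "s \<in> {\<delta>..2*pi-\<delta>}" "cis (real m * t) = cis s" using angle t by blast
      have cism: "(of_real r * cis t) ^ m = of_real (r ^ m) * cis s" for r
        using s by (simp add: power_mult_distrib Complex.DeMoivre)
      have RT: "norm (R t - T (cis t)) < \<epsilon>/2" using qR t by (simp add: T_def)
      have pcis: "poly p (cis t) = (cis s * poly e (cis s)) * T (cis t)"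
        using pT[of "cis t"] cism[of 1] by (simp only: of_real_1 mult_1 power_one cis_neq_zero not_False_eq_True)
      have "R t - poly p (cis t) = (R t - T (cis t)) + (1 - cis s * poly e (cis s)) * T (cis t)"
        unfolding pcis by (simp only: left_diff_distrib) simp
      also have "norm \<dots> \<le> norm (R t - T (cis t)) + norm (1 - cis s * poly e (cis s)) * norm (T (cis t))"
        by (metis norm_mult norm_triangle_ineq)
      also have "\<dots> \<le> \<epsilon>/2 + \<epsilon>/(2*Q) * Q"
        using RT e(1)[OF s(1)] TQ[of t] \<epsilon> Q(1) by (intro add_mono mult_mono) auto
      also have "\<dots> = \<epsilon>" using Q(1) by simp
      finally show "norm (R t - poly p (cis t)) \<le> \<epsilon>" .
      fix r :: real assume r: "r \<in> {0..1}"
      show "norm (poly p (of_real r * cis t)) \<le> C * (norm (R t) + \<epsilon>) + \<epsilon>"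
      proof (cases "r \<le> \<sigma>")
        case True
        then have "norm (poly p (of_real r * cis t)) \<le> \<epsilon>" using r by (intro small) (simp add: norm_mult)
        moreover have "0 \<le> C * (norm (R t) + \<epsilon>)" using C \<epsilon> by simp
        ultimately show ?thesis by linarith
      next
        case False
        define z where "z = of_real r * cis t"
        have r': "\<sigma> < r" "r \<le> 1" using False r by auto
        have "z \<in> X" "cis t \<in> X" using r' \<sigma> by (auto simp: X_def z_def norm_mult)
        moreover have "dist z (cis t) < d"
        proof -
          have "z - cis t = of_real (r - 1) * cis t" by (simp add: z_def algebra_simps)
          then have "dist z (cis t) = \<bar>r - 1\<bar>" by (simp add: dist_norm norm_mult del: of_real_diff)
          then show ?thesis using r' \<sigma> d by auto
        qed
        ultimately have "norm (T z - T (cis t)) < \<epsilon>/2" using d(2) by (simp add: dist_norm)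
        then have "norm (T z) \<le> norm (R t) + \<epsilon>"
          using RT norm_triangle_sub[of "T z" "T (cis t)"] norm_triangle_sub[of "T (cis t)" "R t"]
            norm_minus_commute[of "R t" "T (cis t)"] by linarith
        moreover have "norm (z ^ m * poly e (z ^ m)) \<le> C"
          using e(2)[OF s(1), of "r ^ m"] r by (simp add: z_def cism power_le_one)
        moreover have "poly p z = (z ^ m * poly e (z ^ m)) * T z"
          using r' \<sigma> by (intro pT) (auto simp: z_def)
        ultimately have "norm (poly p z) \<le> C * (norm (R t) + \<epsilon>)"
          using C by (simp add: norm_mult mult_mono)
        then show ?thesis using \<epsilon> by (simp add: z_def)
      qed
    qed
  qed
qed

section \<open>Prescribed radial limits\<close>

text \<open>The exceptional sets have summable measures, so by Borel-Cantelli almost every angle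
  lies in only finitely many of them. For such an angle the series converges uniformly on the closed
  radius. Its sum is continuous up to the end point, where it equals \<open>H t\<close>.\<close>

lemma exists_holomorphic_with_radial_limits:
  assumes H: "H \<in> borel_measurable (lebesgue_on {0..2*pi})"
  shows "\<exists>f N. f holomorphic_on ball 0 1 \<and> N \<in> null_sets lebesgue \<and>
    (\<forall>t\<in>{0..2*pi} - N. ((\<lambda>r. f (of_real r * cis t)) \<longlongrightarrow> H t) (at_left 1))"
proof -
  define good where "good n C R \<epsilon> \<rho> p B \<longleftrightarrow> B \<in> lmeasurable \<and> measure lebesgue B \<le> 5 * (1/2) ^ n \<and>
        (\<forall>z\<in>cball 0 \<rho>. norm (poly p z) \<le> \<epsilon>) \<and>
        (\<forall>t\<in>{0..2*pi} - B. norm (R t - poly p (cis t)) \<le> \<epsilon> \<and>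
           (\<forall>r\<in>{0..1}. norm (poly p (of_real r * cis t)) \<le> C * (norm (R t) + \<epsilon>) + \<epsilon>))"
    for n C \<epsilon> \<rho> p B and R :: "real \<Rightarrow> complex"
  have "\<exists>C>0. \<forall>R \<epsilon> \<rho>. R \<in> borel_measurable (lebesgue_on {0..2*pi}) \<longrightarrow> 0 < \<epsilon> \<longrightarrow> \<rho> < 1 \<longrightarrow>
      (\<exists>p B. good n C R \<epsilon> \<rho> p B)" for n
    unfolding good_def
    by (rule radial_approximation_step[of "(1/2)^n"]) (auto simp: power_le_one)
  then obtain C where C: "\<And>n. C n > 0" and step: "\<And>n R \<epsilon> \<rho>. R \<in> borel_measurable (lebesgue_on {0..2*pi}) \<Longrightarrow>
      0 < \<epsilon> \<Longrightarrow> \<rho> < 1 \<Longrightarrow> \<exists>p B. good n (C n) R \<epsilon> \<rho> p B"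
    by metis
  \<comment> \<open>Stage \<open>n\<close> leaves a residual of at most \<open>\<epsilon> n\<close>,
    which the radial bound of the next stage multiplies by \<open>C (Suc n)\<close>. This choice is
    possible because the constants are known before any accuracy is fixed.\<close>
  define \<epsilon> where "\<epsilon> n = (1/2) ^ n / (C n + C (Suc n) + 1)" for n
  have D: "C n + C (Suc n) + 1 > 0" for n using C[of n] C[of "Suc n"] by linarith
  have \<epsilon>: "\<epsilon> n > 0" for n using D[of n] by (simp add: \<epsilon>_def)
  have le: "x * \<epsilon> n \<le> (1/2) ^ n" if "0 \<le> x" "x \<le> C n + C (Suc n) + 1" for x n
  proof -
    have "x * \<epsilon> n \<le> (C n + C (Suc n) + 1) * \<epsilon> n" using \<epsilon>[of n] that by (intro mult_right_mono) auto
    also have "\<dots> = (1/2) ^ n" using D[of n] by (simp add: \<epsilon>_def)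
    finally show ?thesis .
  qed
  have \<epsilon>1: "\<epsilon> n \<le> (1/2) ^ n" and \<epsilon>2: "C n * \<epsilon> n \<le> (1/2) ^ n" and \<epsilon>3: "C (Suc n) * \<epsilon> n \<le> (1/2) ^ n" for n
    using C[of n] C[of "Suc n"] le[of 1 n] le[of "C n" n] le[of "C (Suc n)" n] by auto
  \<comment> \<open>These radii tend to \<open>1\<close>, so each compact part of the open disk is
    eventually covered and the series converges locally uniformly.\<close>
  define \<rho> where "\<rho> n = 1 - (1/2::real) ^ n" for n :: nat
  have meas: "(\<lambda>t. H t - poly s (cis t)) \<in> borel_measurable (lebesgue_on {0..2*pi})" for s
  proof (rule borel_measurable_diff[OF H])
    show "(\<lambda>t. poly s (cis t)) \<in> borel_measurable (lebesgue_on {0..2*pi})"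
      by (intro continuous_imp_measurable_on_sets_lebesgue continuous_intros) auto
  qed
  \<comment> \<open>The step is solved for every possible partial sum \<open>s\<close>, so that the
    choice functions can be iterated.\<close>
  have "\<exists>p B. good n (C n) (\<lambda>t. H t - poly s (cis t)) (\<epsilon> n) (\<rho> n) p B" for n s
    by (intro step meas \<epsilon>) (simp add: \<rho>_def)
  then obtain q B where qB: "\<And>n s. good n (C n) (\<lambda>t. H t - poly s (cis t)) (\<epsilon> n) (\<rho> n) (q n s) (B n s)"
    by metis
  define S where "S = rec_nat 0 (\<lambda>n s. s + q n s)"
  have S0: "S 0 = 0" and SS: "S (Suc n) = S n + q n (S n)" for n by (simp_all add: S_def)
  define p where "p n = q n (S n)" for n
  define A where "A n = B n (S n)" for n
  have sumS: "poly (S n) z = (\<Sum>i<n. poly (p i) z)" for n z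
    by (induction n) (simp_all add: S0 SS p_def)
  have good: "good n (C n) (\<lambda>t. H t - poly (S n) (cis t)) (\<epsilon> n) (\<rho> n) (p n) (A n)" for n
    unfolding p_def A_def by (rule qB)
  have A: "A n \<in> lmeasurable" "measure lebesgue (A n) \<le> 5 * (1/2) ^ n" for n
    using good[of n] unfolding good_def by auto
  have small: "norm (poly (p n) z) \<le> (1/2) ^ n" if "norm z \<le> \<rho> n" for n z
  proof -
    have "norm (poly (p n) z) \<le> \<epsilon> n" using good[of n] that unfolding good_def by simp
    then show ?thesis using \<epsilon>1[of n] by linarith
  qed
  have approx: "norm (H t - poly (S (Suc n)) (cis t)) \<le> \<epsilon> n" if "t \<in> {0..2*pi}" "t \<notin> A n" for n t
    using good[of n] that unfolding good_def by (simp add: SS p_def diff_diff_eq)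
  have ray: "norm (poly (p n) (of_real r * cis t)) \<le> C n * (norm (H t - poly (S n) (cis t)) + \<epsilon> n) + \<epsilon> n"
    if "t \<in> {0..2*pi}" "t \<notin> A n" "r \<in> {0..1}" for n t r
    using good[of n] that unfolding good_def by simp
  \<comment> \<open>If \<open>t\<close> is good at two consecutive stages, the residual met by stage
    \<open>Suc n\<close> is at most \<open>\<epsilon> n\<close>, so the constant
    \<open>C (Suc n)\<close> no longer matters.\<close>
  have ray': "norm (poly (p (Suc n)) (of_real r * cis t)) \<le> 3 * (1/2) ^ n"
    if t: "t \<in> {0..2*pi}" "t \<notin> A n" "t \<notin> A (Suc n)" and r: "r \<in> {0..1}" for n t r
  proof -
    have "norm (poly (p (Suc n)) (of_real r * cis t)) \<le> C (Suc n) * (\<epsilon> n + \<epsilon> (Suc n)) + \<epsilon> (Suc n)"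
      using ray[OF t(1,3) r] approx[OF t(1,2)] C[of "Suc n"]
      by (smt (verit, ccfv_SIG) mult_left_mono)
    also have "\<dots> \<le> 3 * (1/2) ^ n"
      using \<epsilon>3[of n] \<epsilon>2[of "Suc n"] \<epsilon>1[of "Suc n"] zero_le_power[of "1/2::real" n]
      unfolding distrib_left power_Suc by linarith
    finally show ?thesis .
  qed
  define N where "N = limsup A"
  have N: "N \<in> null_sets lebesgue"
    unfolding N_def
  proof (rule borel_cantelli_limsup1)
    show "emeasure lebesgue (A n) < \<infinity>" for n using fmeasurableD2[OF A(1)[of n]] by (simp only: infinity_ennreal_def less_top)
    show "summable (\<lambda>n. measure lebesgue (A n))"
      by (rule summable_comparison_test'[of "\<lambda>n. 5 * (1/2) ^ n" 0]) (use A in \<open>auto intro: summable_mult\<close>)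
  qed (use A in auto)
  define f where "f z = (\<Sum>n. poly (p n) z)" for z
  have "f holomorphic_on ball 0 1"
  proof (rule holomorphic_uniform_sequence)
    show "(\<lambda>z. \<Sum>i<n. poly (p i) z) holomorphic_on ball 0 1" for n
      by (intro holomorphic_intros)
    fix z :: complex assume z: "z \<in> ball 0 1"
    define d where "d = (1 - norm z) / 2"
    have d: "d > 0" "norm z + d < 1" using z by (auto simp: d_def field_simps)
    have "(\<lambda>n. (1/2::real) ^ n) \<longlonglongrightarrow> 0" by (intro LIMSEQ_power_zero) auto
    moreover have "1 - norm z - d > 0" using d by simp
    ultimately have "\<forall>\<^sub>F n in sequentially. (1/2::real) ^ n < 1 - norm z - d"
      by (rule order_tendstoD(2))
    then have "\<forall>\<^sub>F n in sequentially. \<forall>w\<in>cball z d. norm (poly (p n) w) \<le> (1/2) ^ n"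
    proof eventually_elim
      case (elim n)
      show ?case
      proof
        fix w assume "w \<in> cball z d"
        then have "norm w \<le> norm z + d"
          using norm_triangle_sub[of w z] by (simp add: dist_norm norm_minus_commute)
        then show "norm (poly (p n) w) \<le> (1/2) ^ n"
          using elim by (intro small) (simp add: \<rho>_def)
      qed
    qed
    then have "uniform_limit (cball z d) (\<lambda>n w. \<Sum>i<n. poly (p i) w) f sequentially"
      unfolding f_def by (rule Weierstrass_m_test_ev) simp
    moreover have "cball z d \<subseteq> ball 0 1"
      using d by (intro cball_subset_ball_iff[THEN iffD2]) (simp add: dist_norm)
    ultimately show "\<exists>d>0. cball z d \<subseteq> ball 0 1 \<and>
        uniform_limit (cball z d) (\<lambda>n w. \<Sum>i<n. poly (p i) w) f sequentially"
      using d by blast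
  qed auto
  moreover have "((\<lambda>r. f (of_real r * cis t)) \<longlongrightarrow> H t) (at_left 1)" if t: "t \<in> {0..2*pi} - N" for t
  proof -
    have "t \<notin> limsup A" using t by (simp add: N_def)
    then have "\<exists>n0. \<forall>n\<ge>n0. t \<notin> A n" by (auto simp: limsup_INF_SUP)
    then obtain n0 where n0: "\<And>n. n \<ge> n0 \<Longrightarrow> t \<notin> A n" by blast
    \<comment> \<open>The bound for \<open>p n\<close> also needs \<open>t\<close> to be good at
      stage \<open>n - 1\<close>, hence the start at \<open>Suc n0\<close>. Shifting the index turns
      \<open>3\<close> into \<open>6\<close>.\<close>
    have "norm (poly (p n) (of_real r * cis t)) \<le> 6 * (1/2) ^ n" if "n \<ge> Suc n0" "r \<in> {0..1}" for n r
    proof -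
      obtain m where m: "n = Suc m" using \<open>n \<ge> Suc n0\<close> by (cases n) auto
      then have "m \<ge> n0" using that by simp
      with m show ?thesis using ray'[of t m r] n0[of m] n0[of n] t that by simp
    qed
    then have "\<forall>\<^sub>F n in sequentially. \<forall>r\<in>{0..1}. norm (poly (p n) (of_real r * cis t)) \<le> 6 * (1/2) ^ n"
      unfolding eventually_sequentially by blast
    then have lim: "uniform_limit {0..1} (\<lambda>n r. \<Sum>i<n. poly (p i) (of_real r * cis t))
        (\<lambda>r. f (of_real r * cis t)) sequentially"
      unfolding f_def by (rule Weierstrass_m_test_ev) (simp add: summable_mult)
    \<comment> \<open>The convergence includes the end point \<open>r = 1\<close>, so the radial
      limit of \<open>f\<close> is the sum of the series at \<open>cis t\<close>.\<close>
    have "continuous_on {0..1::real} (\<lambda>r. f (of_real r * cis t))"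
      by (rule uniform_limit_theorem[OF _ lim]) (auto intro!: always_eventually continuous_intros)
    then have "((\<lambda>r. f (of_real r * cis t)) \<longlongrightarrow> f (of_real 1 * cis t)) (at 1 within {0..1})"
      unfolding continuous_on_def by (rule bspec) simp
    moreover have "at 1 within {0..1} = at_left (1::real)"
      by (rule at_within_Icc_at_left) simp
    moreover have "f (of_real 1 * cis t) = H t"
    proof (rule LIMSEQ_unique)
      show "(\<lambda>n. poly (S (Suc n)) (cis t)) \<longlonglongrightarrow> f (of_real 1 * cis t)"
        using LIMSEQ_Suc[OF tendsto_uniform_limitI[OF lim, of 1]] by (simp add: sumS)
      have "(\<lambda>n. poly (S (Suc n)) (cis t) - H t) \<longlonglongrightarrow> 0"
      proof (rule Lim_null_comparison)
        show "\<forall>\<^sub>F n in sequentially. norm (poly (S (Suc n)) (cis t) - H t) \<le> (1/2) ^ n"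
          unfolding eventually_sequentially
        proof (intro exI[of _ n0] allI impI)
          fix n assume "n \<ge> n0"
          then show "norm (poly (S (Suc n)) (cis t) - H t) \<le> (1/2) ^ n"
            using approx[of t n] n0[of n] t \<epsilon>1[of n] by (simp add: norm_minus_commute)
        qed
        show "(\<lambda>n. (1/2::real) ^ n) \<longlonglongrightarrow> 0" by (intro LIMSEQ_power_zero) auto
      qed
      then show "(\<lambda>n. poly (S (Suc n)) (cis t)) \<longlonglongrightarrow> H t" by (rule LIM_zero_cancel)
    qed
    ultimately show ?thesis by simp
  qed
  ultimately show ?thesis using N by blast
qed

section \<open>Ambiguous points\<close>

text \<open>A rational number chosen in the gap to the right of each point determines that
  point.\<close>

lemma countable_right_isolated:
  fixes E :: "real set"
  assumes "\<And>x. x \<in> E \<Longrightarrow> \<exists>y>x. {x<..<y} \<inter> E = {}"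
  shows "countable E"
proof -
  obtain y where y: "\<And>x. x \<in> E \<Longrightarrow> x < y x" "\<And>x. x \<in> E \<Longrightarrow> {x<..<y x} \<inter> E = {}"
    using assms by metis
  have "\<exists>q. q \<in> \<rat> \<and> x < q \<and> q < y x" if "x \<in> E" for x
    using Rats_dense_in_real[OF y(1)[OF that]] by blast
  then obtain q where q: "\<And>x. x \<in> E \<Longrightarrow> q x \<in> \<rat> \<and> x < q x \<and> q x < y x" by metis
  have "x \<le> x'" if "x \<in> E" "x' \<in> E" "q x = q x'" for x x'
  proof (rule ccontr)
    assume "\<not> x \<le> x'"
    then have "x \<in> {x'<..<y x'}" using q[OF that(1)] q[OF that(2)] that(3) by auto
    then show False using y(2)[OF that(2)] that(1) by blast
  qed
  then have "inj_on q E" by (intro inj_onI antisym) auto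
  moreover have "countable (q ` E)" using q countable_rat by (auto intro: countable_subset[of _ "\<rat>"])
  ultimately show ?thesis by (rule countable_image_inj_on[rotated])
qed

text \<open>Points with a gap on the left are reflected to points with a gap on the right.\<close>

lemma countable_one_sided_isolated:
  fixes E :: "real set"
  assumes "\<And>x. x \<in> E \<Longrightarrow> \<exists>y. y \<noteq> x \<and> open_segment x y \<inter> E = {}"
  shows "countable E"
proof -
  define R where "R = {x \<in> E. \<exists>y>x. {x<..<y} \<inter> E = {}}"
  define L where "L = {x \<in> E. \<exists>y<x. {y<..<x} \<inter> E = {}}"
  have "countable R"
  proof (rule countable_right_isolated)
    fix x assume "x \<in> R"
    then obtain y where "y > x" "{x<..<y} \<inter> E = {}" by (auto simp: R_def)
    moreover have "{x<..<y} \<inter> R \<subseteq> {x<..<y} \<inter> E" by (auto simp: R_def)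
    ultimately show "\<exists>y>x. {x<..<y} \<inter> R = {}" by blast
  qed
  have "countable (uminus ` L)"
  proof (rule countable_right_isolated)
    fix x assume "x \<in> uminus ` L"
    then obtain v where "v \<in> L" "x = - v" by (rule imageE)
    then have "- x \<in> L" by simp
    then obtain y where y: "y < - x" "{y<..<- x} \<inter> E = {}" unfolding L_def by blast
    have "{x<..<- y} \<inter> uminus ` L = {}"
    proof (rule ccontr)
      assume "{x<..<- y} \<inter> uminus ` L \<noteq> {}"
      then obtain u where u: "u \<in> {x<..<- y}" "u \<in> uminus ` L" by blast
      then obtain v where "v \<in> L" "u = - v" by blast
      then have "v \<in> {y<..<- x} \<inter> E" using u(1) by (simp add: L_def)
      then show False using y by blast
    qed
    moreover have "- y > x" using y(1) by simp
    ultimately show "\<exists>y>x. {x<..<y} \<inter> uminus ` L = {}" by blast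
  qed
  then have "countable L" by (rule countable_image_inj_on) (simp add: inj_on_def)
  have "E \<subseteq> R \<union> L"
  proof
    fix x assume "x \<in> E"
    then obtain y where y: "y \<noteq> x" "open_segment x y \<inter> E = {}" using assms by blast
    show "x \<in> R \<union> L"
    proof (cases "x < y")
      case True
      then have "{x<..<y} \<inter> E = {}" using y(2) by (simp add: open_segment_eq_real_ivl)
      then show ?thesis using True \<open>x \<in> E\<close> unfolding R_def by blast
    next
      case False
      then have "y < x" using y(1) by simp
      then have "{y<..<x} \<inter> E = {}" using y(2) by (simp add: open_segment_eq_real_ivl)
      then show ?thesis using \<open>y < x\<close> \<open>x \<in> E\<close> unfolding L_def by blast
    qed
  qed
  moreover have "countable (R \<union> L)" using \<open>countable R\<close> \<open>countable L\<close> by simp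
  ultimately show ?thesis by (rule countable_subset)
qed

lemma continuous_on_end_nhd:
  fixes g :: "real \<Rightarrow> 'a::topological_space"
  assumes g: "continuous_on {a..1} g" and a: "a < 1" and U: "open U" "g 1 \<in> U"
  obtains b where "a \<le> b" "b < 1" "\<forall>s\<in>{b..1}. g s \<in> U"
proof -
  have "(g \<longlongrightarrow> g 1) (at 1 within {a..1})" using g a by (simp add: continuous_on_def)
  then have "(g \<longlongrightarrow> g 1) (at_left 1)" using at_within_Icc_at_left[OF a] by simp
  then have "eventually (\<lambda>s. g s \<in> U) (at_left 1)" using U by (simp add: tendsto_def)
  then have "\<exists>c<1. \<forall>s>c. s < 1 \<longrightarrow> g s \<in> U" unfolding eventually_at_left[OF a] .
  then obtain c where c: "c < 1" "\<And>s. c < s \<Longrightarrow> s < 1 \<Longrightarrow> g s \<in> U" by blast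
  define b where "b = max a ((c + 1) / 2)"
  show ?thesis
  proof (rule that[of b])
    show "a \<le> b" "b < 1" using a c by (auto simp: b_def)
    show "\<forall>s\<in>{b..1}. g s \<in> U"
    proof
      fix s assume s: "s \<in> {b..1}"
      then have "c < s" using c by (auto simp: b_def)
      then show "g s \<in> U" using c(2)[of s] s U(2) by (cases "s = 1") auto
    qed
  qed
qed

lemma cis_Arg2pi_of_norm_1: "norm z = 1 \<Longrightarrow> cis (Arg2pi z) = z"
  using complex_norm_eq_1_exp[of z] by (simp add: cis_conv_exp)

text \<open>By the intermediate value theorem the argument of a curve of the hypothesis sweeps an interval
  on one side of its end point which contains no argument of \<open>E\<close>.\<close>

lemma countable_circle_set_avoided_by_curves:
  fixes E :: "complex set"
  assumes E: "E \<subseteq> sphere 0 1"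
    and curve: "\<And>\<zeta>. \<zeta> \<in> E \<Longrightarrow> \<exists>g a. a < (1::real) \<and> continuous_on {a..1} g \<and> g 1 = \<zeta> \<and>
      (\<forall>s\<in>{a..<1}. g s \<noteq> 0 \<and> sgn (g s) \<notin> E)"
  shows "countable E"
proof -
  \<comment> \<open>The point \<open>1\<close> is set aside because \<open>Arg2pi\<close> jumps
    there; it is added back at the end.\<close>
  define X where "X = Arg2pi ` (E - {1})"
  have "countable X"
  proof (rule countable_one_sided_isolated)
    fix x assume "x \<in> X"
    then obtain \<zeta> where \<zeta>: "\<zeta> \<in> E" "\<zeta> \<noteq> 1" "x = Arg2pi \<zeta>" by (auto simp: X_def)
    have n1: "norm \<zeta> = 1" using \<zeta> E by auto
    obtain g and a :: real where g: "a < 1" "continuous_on {a..1} g" "g 1 = \<zeta>"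
      "\<forall>s\<in>{a..<1}. g s \<noteq> 0 \<and> sgn (g s) \<notin> E" using curve[OF \<zeta>(1)] by blast
    have nz: "g s \<noteq> 0" if "s \<in> {a..1}" for s
      using g(3,4) n1 that by (cases "s = 1") auto
    define h where "h s = sgn (g s)" for s
    have h: "continuous_on {a..1} h"
      unfolding h_def sgn_div_norm using g(2) nz by (intro continuous_intros) auto
    have h1: "h 1 = \<zeta>" using g(3) n1 by (simp add: h_def sgn_div_norm)
    have "\<zeta> \<notin> \<real>\<^sub>\<ge>\<^sub>0"
      using n1 \<zeta>(2) by (auto simp: nonneg_Reals_def norm_of_real)
    then have "h 1 \<in> - \<real>\<^sub>\<ge>\<^sub>0" using h1 by simp
    then obtain b where b: "a \<le> b" "b < 1" "\<forall>s\<in>{b..1}. h s \<in> - \<real>\<^sub>\<ge>\<^sub>0"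
      by (rule continuous_on_end_nhd[OF h g(1) open_Compl[OF closed_nonneg_Reals_complex]]) (rule that)
    have \<theta>: "continuous_on {b..1} (\<lambda>s. Arg2pi (h s))"
    proof (rule continuous_on_compose2[of "- \<real>\<^sub>\<ge>\<^sub>0" Arg2pi])
      show "continuous_on (- \<real>\<^sub>\<ge>\<^sub>0) Arg2pi"
        by (intro continuous_at_imp_continuous_on ballI continuous_at_Arg2pi) auto
      show "continuous_on {b..1} h" using h b by (rule_tac continuous_on_subset) auto
    qed (use b in auto)
    have avoid: "Arg2pi (h s) \<notin> X" if "s \<in> {b..<1}" for s
    proof
      assume "Arg2pi (h s) \<in> X"
      then obtain \<xi> where \<xi>: "\<xi> \<in> E" "Arg2pi (h s) = Arg2pi \<xi>" by (auto simp: X_def)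
      have "norm (h s) = 1" using nz[of s] that b by (simp add: h_def norm_sgn)
      then have "h s = \<xi>"
        using \<xi> E cis_Arg2pi_of_norm_1[of "h s"] cis_Arg2pi_of_norm_1[of \<xi>] by force
      then show False using g(4) \<xi>(1) that b by (auto simp: h_def)
    qed
    define y where "y = Arg2pi (h b)"
    have "y \<noteq> x" using avoid[of b] b \<open>x \<in> X\<close> by (auto simp: y_def)
    moreover have "open_segment x y \<inter> X = {}"
    proof (rule ccontr)
      assume "open_segment x y \<inter> X \<noteq> {}"
      then obtain v where v: "v \<in> open_segment x y" "v \<in> X" by blast
      have "connected ((\<lambda>s. Arg2pi (h s)) ` {b..1})"
        by (rule connected_continuous_image[OF \<theta>]) auto
      moreover have "x \<in> (\<lambda>s. Arg2pi (h s)) ` {b..1}" "y \<in> (\<lambda>s. Arg2pi (h s)) ` {b..1}"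
        using b(2) h1 \<zeta>(3) by (auto simp: y_def intro!: image_eqI[of _ _ 1])
      \<comment> \<open>Every value strictly between \<open>x\<close> and \<open>y\<close> is the
        argument of some \<open>h s\<close> with \<open>s < 1\<close>, and these arguments avoid
        \<open>X\<close>.\<close>
      ultimately have "closed_segment x y \<subseteq> (\<lambda>s. Arg2pi (h s)) ` {b..1}"
        by (intro closed_segment_subset) (simp_all add: is_interval_connected_1[symmetric] is_interval_convex_1[symmetric])
      then obtain s where s: "s \<in> {b..1}" "v = Arg2pi (h s)" using v(1) by (auto simp: open_segment_def)
      have "s \<noteq> 1" using s(2) h1 \<zeta>(3) v(1) by (auto simp: open_segment_def)
      then show False using avoid[of s] s v(2) by auto
    qed
    ultimately show "\<exists>y. y \<noteq> x \<and> open_segment x y \<inter> X = {}" by blast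
  qed
  moreover have "E \<subseteq> insert 1 (cis ` X)"
  proof
    fix \<zeta> assume "\<zeta> \<in> E"
    then have "\<zeta> = cis (Arg2pi \<zeta>)" using E cis_Arg2pi_of_norm_1[of \<zeta>] by auto
    then show "\<zeta> \<in> insert 1 (cis ` X)" using \<open>\<zeta> \<in> E\<close> by (auto simp: X_def)
  qed
  ultimately show ?thesis by (meson countable_image countable_insert countable_subset)
qed

text \<open>A case of Bagemihl's ambiguous point theorem: one of the two curves is the radius.\<close>

lemma countable_radially_ambiguous_points:
  fixes f :: "complex \<Rightarrow> complex"
  shows "countable {\<zeta> \<in> sphere 0 1. \<exists>w g. ((\<lambda>r. f (of_real r * \<zeta>)) \<longlongrightarrow> w) (at_left 1) \<and>
      continuous_on {0..1} g \<and> g ` {0..<1} \<subseteq> ball 0 1 \<and> g 1 = \<zeta> \<and>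
      \<not> (\<exists>s::nat \<Rightarrow> real. (\<forall>n. s n \<in> {0..<1}) \<and> s \<longlonglongrightarrow> 1 \<and> (\<lambda>n. f (g (s n))) \<longlonglongrightarrow> w)}"
    (is "countable ?A")
proof -
  obtain Q :: "complex set" where Q: "countable Q" "\<And>U. open U \<Longrightarrow> U \<noteq> {} \<Longrightarrow> \<exists>d\<in>Q. d \<in> U"
    using countable_dense_exists by metis
  define \<rho> where "\<rho> j = 1 - 1 / real (Suc j)" for j
  define \<delta> where "\<delta> k = 1 / real (Suc k)" for k
  \<comment> \<open>For points in one such class, \<open>f\<close> lies in the ball on the outer
    part of each radius, while the curves stay outside the ball in the same annulus. So no curve of
    one point meets the outer radius of another point of the class.\<close>
  define E where "E = (\<lambda>(w, k, j). {\<zeta> \<in> sphere 0 1.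
      (\<forall>r\<in>{\<rho> j<..<1}. f (of_real r * \<zeta>) \<in> ball w (\<delta> k)) \<and>
      (\<exists>g (a::real). a < 1 \<and> continuous_on {a..1} g \<and> g 1 = \<zeta> \<and>
         (\<forall>s\<in>{a..<1}. norm (g s) \<in> {\<rho> j<..<1} \<and> f (g s) \<notin> ball w (\<delta> k)))})"
  have "countable (E wkj)" for wkj
  proof -
    obtain w k j where wkj: "wkj = (w, k, j)" by (cases wkj)
    have "\<rho> j \<ge> 0" by (simp add: \<rho>_def)
    show ?thesis
    proof (rule countable_circle_set_avoided_by_curves)
      show "E wkj \<subseteq> sphere 0 1" by (auto simp: E_def wkj)
      fix \<zeta> assume "\<zeta> \<in> E wkj"
      then have "\<exists>g (a::real). a < 1 \<and> continuous_on {a..1} g \<and> g 1 = \<zeta> \<and>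
         (\<forall>s\<in>{a..<1}. norm (g s) \<in> {\<rho> j<..<1} \<and> f (g s) \<notin> ball w (\<delta> k))"
        unfolding E_def wkj prod.case by (elim CollectE conjE)
      then obtain g and a :: real where g: "a < 1" "continuous_on {a..1} g" "g 1 = \<zeta>"
        "\<forall>s\<in>{a..<1}. norm (g s) \<in> {\<rho> j<..<1} \<and> f (g s) \<notin> ball w (\<delta> k)"
        by (elim exE conjE) (rule that)
      have "g s \<noteq> 0 \<and> sgn (g s) \<notin> E wkj" if s: "s \<in> {a..<1}" for s
      proof -
        have gs: "norm (g s) \<in> {\<rho> j<..<1}" "f (g s) \<notin> ball w (\<delta> k)" using g(4) s by auto
        have "g s \<noteq> 0" using gs(1) \<open>\<rho> j \<ge> 0\<close> by auto
        then have eq: "of_real (norm (g s)) * sgn (g s) = g s"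
          by (simp add: sgn_div_norm scaleR_conv_of_real)
        have "sgn (g s) \<notin> E wkj"
        proof
          assume "sgn (g s) \<in> E wkj"
          then have "f (of_real (norm (g s)) * sgn (g s)) \<in> ball w (\<delta> k)"
            using gs(1) unfolding E_def wkj by blast
          then show False using gs(2) eq by simp
        qed
        then show ?thesis using \<open>g s \<noteq> 0\<close> by simp
      qed
      then show "\<exists>g (a::real). a < 1 \<and> continuous_on {a..1} g \<and> g 1 = \<zeta> \<and>
          (\<forall>s\<in>{a..<1}. g s \<noteq> 0 \<and> sgn (g s) \<notin> E wkj)" using g by blast
    qed
  qed
  moreover have "countable (Q \<times> (UNIV :: nat set) \<times> (UNIV :: nat set))" using Q(1) by (intro countable_SIGMA) auto
  ultimately have "countable (\<Union>wkj\<in>Q \<times> UNIV \<times> UNIV. E wkj)" by (intro countable_UN)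
  moreover have "?A \<subseteq> (\<Union>wkj\<in>Q \<times> UNIV \<times> UNIV. E wkj)"
  proof
    fix \<zeta> assume "\<zeta> \<in> ?A"
    then obtain w g where \<zeta>: "norm \<zeta> = 1" and lim: "((\<lambda>r. f (of_real r * \<zeta>)) \<longlongrightarrow> w) (at_left 1)"
      and g: "continuous_on {0..1} g" "g ` {0..<1} \<subseteq> ball 0 1" "g 1 = \<zeta>"
      and no: "\<not> (\<exists>s::nat \<Rightarrow> real. (\<forall>n. s n \<in> {0..<1}) \<and> s \<longlonglongrightarrow> 1 \<and> (\<lambda>n. f (g (s n))) \<longlonglongrightarrow> w)"
      by auto
    have pos: "\<delta> i > 0" "0 \<le> \<rho> i" "\<rho> i < 1" for i by (auto simp: \<delta>_def \<rho>_def)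
    \<comment> \<open>Otherwise parameters \<open>s n \<ge> \<rho> n\<close> with values within
      \<open>\<delta> n\<close> of \<open>w\<close> would form a sequence excluded by the choice of
      \<open>g\<close>.\<close>
    have "\<exists>n. \<forall>s\<in>{\<rho> n..<1}. dist (f (g s)) w \<ge> \<delta> n"
    proof (rule ccontr)
      assume "\<not> ?thesis"
      then have "\<forall>n. \<exists>s. s \<in> {\<rho> n..<1} \<and> dist (f (g s)) w < \<delta> n" by force
      then obtain s where s: "\<And>n. s n \<in> {\<rho> n..<1}" "\<And>n. dist (f (g (s n))) w < \<delta> n" by metis
      have \<delta>0: "\<delta> \<longlonglongrightarrow> 0" unfolding \<delta>_def using LIMSEQ_inverse_real_of_nat by (simp add: inverse_eq_divide)
      have "\<rho> = (\<lambda>j. 1 - \<delta> j)" by (simp add: fun_eq_iff \<rho>_def \<delta>_def)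
      then have \<rho>1: "\<rho> \<longlonglongrightarrow> 1" using tendsto_diff[OF tendsto_const[of 1] \<delta>0] by simp
      have "s \<longlonglongrightarrow> 1"
      proof (rule tendsto_sandwich[OF _ _ \<rho>1 tendsto_const])
        show "\<forall>\<^sub>F n in sequentially. \<rho> n \<le> s n" using s(1) by (intro always_eventually allI) simp
        show "\<forall>\<^sub>F n in sequentially. s n \<le> 1" using s(1) by (intro always_eventually allI) (simp add: less_imp_le)
      qed
      moreover have "(\<lambda>n. f (g (s n))) \<longlonglongrightarrow> w"
        unfolding tendsto_dist_iff[of _ w]
      proof (rule tendsto_sandwich[OF _ _ tendsto_const \<delta>0])
        show "\<forall>\<^sub>F n in sequentially. dist (f (g (s n))) w \<le> \<delta> n"
          using s(2) by (intro always_eventually allI less_imp_le)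
      qed simp
      moreover have "s n \<in> {0..<1}" for n using s(1)[of n] pos(2)[of n] by simp
      ultimately show False using no by blast
    qed
    then obtain n where n: "\<forall>s\<in>{\<rho> n..<1}. dist (f (g s)) w \<ge> \<delta> n" by blast
    \<comment> \<open>Since \<open>2 * \<delta> k = \<delta> n\<close>, a ball of radius
      \<open>\<delta> k\<close> around a centre closer than \<open>\<delta> k\<close> to
      \<open>w\<close> contains \<open>w\<close> and lies inside the ball of radius
      \<open>\<delta> n\<close> around \<open>w\<close>. The radius therefore enters it and the
      curve avoids it.\<close>
    define k where "k = 2 * n + 1"
    have k: "2 * \<delta> k = \<delta> n" by (simp add: \<delta>_def k_def field_simps)
    have "ball w (\<delta> k) \<noteq> {}" using pos(1)[of k] by simp
    with Q(2)[OF open_ball] obtain w0 where w0: "w0 \<in> Q" "dist w w0 < \<delta> k" by (auto simp: mem_ball)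
    have "eventually (\<lambda>r. f (of_real r * \<zeta>) \<in> ball w0 (\<delta> k)) (at_left 1)"
      using w0(2) by (intro topological_tendstoD[OF lim]) (auto simp: dist_commute)
    then have "\<exists>c<1. \<forall>r>c. r < 1 \<longrightarrow> f (of_real r * \<zeta>) \<in> ball w0 (\<delta> k)"
      unfolding eventually_at_left[OF zero_less_one] .
    then obtain c where c: "c < 1" "\<And>r. c < r \<Longrightarrow> r < 1 \<Longrightarrow> f (of_real r * \<zeta>) \<in> ball w0 (\<delta> k)"
      by blast
    obtain j where j: "1 / real (Suc j) < 1 - c" using c(1) nat_approx_posE[of "1 - c"] by auto
    then have cj: "c < \<rho> j" by (simp add: \<rho>_def)
    have "continuous_on {\<rho> n..1} g" using g(1) pos(2)[of n] by (rule_tac continuous_on_subset) auto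
    moreover have "g 1 \<in> - cball 0 (\<rho> j)" using g(3) \<zeta> pos(3)[of j] by simp
    ultimately obtain a where a: "\<rho> n \<le> a" "a < 1" "\<forall>s\<in>{a..1}. g s \<in> - cball 0 (\<rho> j)"
      using continuous_on_end_nhd[OF _ pos(3)[of n] open_Compl[OF closed_cball], of g 0 "\<rho> j"] by metis
    have "\<zeta> \<in> E (w0, k, j)"
      unfolding E_def prod.case
    proof (intro CollectI conjI exI[of _ g] exI[of _ a] ballI)
      show "continuous_on {a..1} g" using g(1) a pos(2)[of n] by (rule_tac continuous_on_subset) auto
      fix s assume s: "s \<in> {a..<1}"
      have "g s \<in> ball 0 1" using g(2) s a pos(2)[of n] by (intro subsetD[OF g(2)] imageI) auto
      moreover have "g s \<in> - cball 0 (\<rho> j)" using a(3) s by simp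
      ultimately show "norm (g s) \<in> {\<rho> j<..<1}" by simp
      have "dist (f (g s)) w \<ge> \<delta> n" using n s a(1) by auto
      then show "f (g s) \<notin> ball w0 (\<delta> k)"
        using w0(2) k dist_triangle[of "f (g s)" w w0] by (auto simp: dist_commute)
    qed (use \<zeta> g(3) a c(2) cj in auto)
    then show "\<zeta> \<in> (\<Union>wkj\<in>Q \<times> UNIV \<times> UNIV. E wkj)" using w0(1) by blast
  qed
  ultimately show ?thesis by (rule countable_subset[rotated])
qed

section \<open>Transfer to the domain\<close>

lemma cis_vimage_countable_null:
  assumes "countable A"
  shows "{t \<in> {0..2*pi}. cis t \<in> A} \<in> null_sets lebesgue"
proof -
  \<comment> \<open>\<open>cis\<close> is injective on the interval without its right end point,
    where \<open>Arg2pi\<close> returns \<open>0\<close>.\<close>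
  have "t = 2*pi \<or> t \<in> Arg2pi ` A" if "t \<in> {0..2*pi}" "cis t \<in> A" for t
  proof (cases "t = 2*pi")
    case False
    then have "Arg2pi (cis t) = t"
      using that by (intro Arg2pi_unique[of 1]) (auto simp: cis_conv_exp)
    then show ?thesis using that(2) by (metis image_eqI)
  qed simp
  then have "{t \<in> {0..2*pi}. cis t \<in> A} \<subseteq> insert (2*pi) (Arg2pi ` A)" by auto
  moreover have "countable (insert (2*pi) (Arg2pi ` A))" using assms by simp
  ultimately have "countable {t \<in> {0..2*pi}. cis t \<in> A}" by (rule countable_subset)
  then show ?thesis by (intro null_sets_completionI countable_imp_null_set_lborel)
qed

text \<open>An explicit inverse \<open>\<omega>'\<close> is carried along;
  \<open>inv_into_eq\<close> identifies it on the closed disk with the inverse in the notion of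
  measurability.\<close>

locale conformal_extension =
  fixes D :: "complex set" and \<omega> \<omega>' :: "complex \<Rightarrow> complex"
  assumes openD: "open D" and hol: "\<omega> holomorphic_on D" and img: "\<omega> ` D = ball 0 1"
    and homeo: "homeomorphism (closure D) (cball 0 1) \<omega> \<omega>'"
begin

lemma inv_left: "z \<in> closure D \<Longrightarrow> \<omega>' (\<omega> z) = z"
  and inv_right: "w \<in> cball 0 1 \<Longrightarrow> \<omega> (\<omega>' w) = w"
  and inv_mem: "w \<in> cball 0 1 \<Longrightarrow> \<omega>' w \<in> closure D"
  and cont: "continuous_on (closure D) \<omega>"
  and cont_inv: "continuous_on (cball 0 1) \<omega>'"
  using homeo by (auto simp: homeomorphism_def)

lemma inv_inj: "inj_on \<omega>' (cball 0 1)"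
  by (rule inj_on_inverseI[of _ \<omega>]) (rule inv_right)

lemma inv_ball: "w \<in> ball 0 1 \<Longrightarrow> \<omega>' w \<in> D"
  using img inv_left closure_subset by (metis imageE subsetD)

lemma map_ball: "z \<in> D \<Longrightarrow> \<omega> z \<in> ball 0 1"
  using img by blast

lemma frontier_eq: "frontier D = closure D - D"
  using openD by (simp add: frontier_def interior_open)

lemma inv_sphere: "norm w = 1 \<Longrightarrow> \<omega>' w \<in> frontier D"
  using inv_mem[of w] inv_right[of w] map_ball[of "\<omega>' w"] by (auto simp: frontier_eq)

lemma inv_into_eq: "w \<in> cball 0 1 \<Longrightarrow> inv_into (closure D) \<omega> w = \<omega>' w"
  using inv_left inv_right inv_mem by (intro inv_into_f_eq inj_on_inverseI[of _ \<omega>']) auto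

text \<open>The preimage of a radius is an arc along which the limit exists, hence only this limit can be a
  principal asymptotic value.\<close>

lemma principal_asymptotic_values_radial:
  assumes w: "norm w = 1" and lim: "((\<lambda>r. \<Omega> (\<omega>' (of_real r * w))) \<longlongrightarrow> c) (at_left 1)"
  shows "principal_asymptotic_values D \<Omega> (\<omega>' w) \<subseteq> {Some c}"
proof -
  define \<gamma> where "\<gamma> s = \<omega>' (of_real s * w)" for s
  have mem: "of_real s * w \<in> cball 0 1" if "s \<in> {0..1}" for s
    using that w by (simp add: norm_mult)
  have "continuous_on {0..1} \<gamma>"
    unfolding \<gamma>_def by (rule continuous_on_compose2[OF cont_inv]) (use mem in \<open>auto intro!: continuous_intros\<close>)
  moreover have "inj_on \<gamma> {0..1}"
  proof (rule inj_onI)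
    fix s t assume st: "s \<in> {0..1}" "t \<in> {0..1}" "\<gamma> s = \<gamma> t"
    then have "of_real s * w = of_real t * w"
      using inj_onD[OF inv_inj] mem by (simp only: \<gamma>_def)
    then show "s = t" using w by auto
  qed
  moreover have \<gamma>D: "\<gamma> s \<in> D" if "s \<in> {0..<1}" for s
    unfolding \<gamma>_def using that w by (intro inv_ball) (simp add: norm_mult)
  ultimately have arc: "arc_to D (\<omega>' w) \<gamma>"
    by (auto simp: arc_to_def arc_def path_def pathfinish_def \<gamma>_def)
  have along: "(\<lambda>n. \<Omega> (z n)) \<longlonglongrightarrow> c"
    if z: "\<forall>n. z n \<in> \<gamma> ` {0..<1}" "z \<longlonglongrightarrow> \<omega>' w" for z :: "nat \<Rightarrow> complex"
  proof -
    have "\<forall>n. \<exists>s. s \<in> {0..<1} \<and> z n = \<gamma> s" using z(1) by blast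
    then obtain s where s: "\<And>n. s n \<in> {0..<1}" "\<And>n. z n = \<gamma> (s n)" by metis
    have \<omega>z: "\<omega> (z n) = of_real (s n) * w" for n
      using s(1)[of n] mem[of "s n"] by (simp add: s(2) \<gamma>_def inv_right)
    have zc: "z n \<in> closure D" for n using s \<gamma>D closure_subset by (metis subsetD)
    have "(\<lambda>n. \<omega> (z n)) \<longlonglongrightarrow> \<omega> (\<omega>' w)"
      using w by (intro continuous_on_tendsto_compose[OF cont z(2)] inv_mem always_eventually allI zc) simp
    \<comment> \<open>The modulus of \<open>\<omega>\<close> recovers the parameter on the radius,
      so approaching the end point forces \<open>s\<close> to tend to \<open>1\<close>.\<close>
    then have "(\<lambda>n. norm (\<omega> (z n))) \<longlonglongrightarrow> norm (\<omega> (\<omega>' w))" by (rule tendsto_norm)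
    moreover have "norm (\<omega> (\<omega>' w)) = 1" using inv_right[of w] w by simp
    moreover have "norm (\<omega> (z n)) = s n" for n using s(1)[of n] w by (simp add: \<omega>z norm_mult)
    ultimately have "s \<longlonglongrightarrow> 1" by simp
    then have "filterlim s (at_left 1) sequentially"
      using s(1) by (intro tendsto_imp_filterlim_at_left always_eventually) auto
    from filterlim_compose[OF lim this] show ?thesis by (simp add: s(2) \<gamma>_def)
  qed
  have "cluster_along \<Omega> \<gamma> (\<omega>' w) \<subseteq> {Some c}"
  proof
    fix v assume "v \<in> cluster_along \<Omega> \<gamma> (\<omega>' w)"
    then consider (fin) u z where "v = Some u" "\<forall>n. z n \<in> \<gamma> ` {0..<1}" "z \<longlonglongrightarrow> \<omega>' w"
          "(\<lambda>n. \<Omega> (z n)) \<longlonglongrightarrow> u"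
      | (inf) z where "v = None" "\<forall>n. z n \<in> \<gamma> ` {0..<1}" "z \<longlonglongrightarrow> \<omega>' w"
          "filterlim (\<lambda>n. norm (\<Omega> (z n))) at_top sequentially"
      unfolding cluster_along_def by blast
    then show "v \<in> {Some c}"
    proof cases
      case fin
      then show ?thesis using along LIMSEQ_unique by blast
    next
      case inf
      then have "(\<lambda>n. norm (\<Omega> (z n))) \<longlonglongrightarrow> norm c" using along tendsto_norm by blast
      then show ?thesis using inf(4) not_tendsto_and_filterlim_at_infinity[of sequentially]
        by (metis filterlim_at_top_imp_at_infinity trivial_limit_sequentially)
    qed
  qed
  then show ?thesis using arc unfolding principal_asymptotic_values_def by blast
qed

text \<open>The radius excludes all values but \<open>\<phi> \<zeta>\<close>. Conversely, off the
  countable set of ambiguous points every arc carries a sequence along which \<open>f\<close> tends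
  to \<open>H t\<close>, and the continuous map
  \<open>w \<mapsto> Re (cnj (lam \<zeta>) * w)\<close> takes this limit to
  \<open>\<phi> \<zeta>\<close>.\<close>

lemma in_classS_if_radial_limits:
  fixes lam :: "complex \<Rightarrow> complex" and \<phi> :: "complex \<Rightarrow> real"
  assumes f: "f holomorphic_on ball 0 1" and N: "N \<in> null_sets lebesgue"
    and lim: "\<And>t. t \<in> {0..2*pi} - N \<Longrightarrow> ((\<lambda>r. f (of_real r * cis t)) \<longlongrightarrow> H t) (at_left 1)"
    and H: "\<And>t. t \<in> {0..2*pi} \<Longrightarrow> Re (cnj (lam (\<omega>' (cis t))) * H t) = \<phi> (\<omega>' (cis t))"
  shows "(\<lambda>z. f (\<omega> z)) \<in> classS D \<omega> lam \<phi>"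
proof -
  define \<Omega> where "\<Omega> \<zeta> = (\<lambda>z. complex_of_real (Re (cnj (lam \<zeta>) * f (\<omega> z))))" for \<zeta>
  define A where "A = {\<zeta> \<in> sphere 0 1. \<exists>w g. ((\<lambda>r. f (of_real r * \<zeta>)) \<longlongrightarrow> w) (at_left 1) \<and>
      continuous_on {0..1} g \<and> g ` {0..<1} \<subseteq> ball 0 1 \<and> g 1 = \<zeta> \<and>
      \<not> (\<exists>s::nat \<Rightarrow> real. (\<forall>n. s n \<in> {0..<1}) \<and> s \<longlonglongrightarrow> 1 \<and> (\<lambda>n. f (g (s n))) \<longlonglongrightarrow> w)}"
  define E where "E = {\<zeta> \<in> frontier D. principal_asymptotic_values D (\<Omega> \<zeta>) \<zeta> \<noteq> {Some (complex_of_real (\<phi> \<zeta>))}}"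
  have key: "principal_asymptotic_values D (\<Omega> \<zeta>) \<zeta> = {Some (complex_of_real (\<phi> \<zeta>))}"
    if t: "t \<in> {0..2*pi} - N" "cis t \<notin> A" and \<zeta>: "\<zeta> = \<omega>' (cis t)" for t \<zeta>
  proof
    have \<phi>: "complex_of_real (\<phi> \<zeta>) = complex_of_real (Re (cnj (lam \<zeta>) * H t))"
      using H[of t] t(1) by (simp add: \<zeta>)
    have "((\<lambda>r. complex_of_real (Re (cnj (lam \<zeta>) * f (of_real r * cis t)))) \<longlongrightarrow> complex_of_real (\<phi> \<zeta>)) (at_left 1)"
      unfolding \<phi> by (intro tendsto_intros lim t(1))
    moreover have "eventually (\<lambda>r. \<Omega> \<zeta> (\<omega>' (of_real r * cis t))
        = complex_of_real (Re (cnj (lam \<zeta>) * f (of_real r * cis t)))) (at_left 1)"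
      unfolding eventually_at_left[OF zero_less_one]
      by (intro exI[of _ 0]) (auto simp: \<Omega>_def inv_right norm_mult)
    ultimately have "((\<lambda>r. \<Omega> \<zeta> (\<omega>' (of_real r * cis t))) \<longlongrightarrow> complex_of_real (\<phi> \<zeta>)) (at_left 1)"
      by (simp only: tendsto_cong)
    then show "principal_asymptotic_values D (\<Omega> \<zeta>) \<zeta> \<subseteq> {Some (complex_of_real (\<phi> \<zeta>))}"
      unfolding \<zeta> by (intro principal_asymptotic_values_radial) simp_all
    have "Some (complex_of_real (\<phi> \<zeta>)) \<in> cluster_along (\<Omega> \<zeta>) \<gamma> \<zeta>" if "arc_to D \<zeta> \<gamma>" for \<gamma>
    proof -
      have \<gamma>: "continuous_on {0..1} \<gamma>" "\<gamma> ` {0..<1} \<subseteq> D" "\<gamma> 1 = \<zeta>"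
        using that by (auto simp: arc_to_def arc_def path_def pathfinish_def)
      have "\<gamma> s \<in> closure D" if "s \<in> {0..1}" for s
      proof (cases "s = 1")
        case True
        then show ?thesis using \<gamma>(3) \<zeta> inv_mem[of "cis t"] by simp
      next
        case False
        then show ?thesis using that \<gamma>(2) closure_subset[of D] by force
      qed
      then have "continuous_on {0..1} (\<lambda>s. \<omega> (\<gamma> s))"
        by (intro continuous_on_compose2[OF cont \<gamma>(1)]) auto
      moreover have "(\<lambda>s. \<omega> (\<gamma> s)) ` {0..<1} \<subseteq> ball 0 1" using \<gamma>(2) map_ball by blast
      moreover have "\<omega> (\<gamma> 1) = cis t" using \<gamma>(3) \<zeta> inv_right[of "cis t"] by simp
      moreover have "((\<lambda>r. f (of_real r * cis t)) \<longlongrightarrow> H t) (at_left 1)" by (rule lim[OF t(1)])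
      moreover have "cis t \<in> sphere 0 1" by simp
      ultimately have "\<exists>s::nat \<Rightarrow> real. (\<forall>n. s n \<in> {0..<1}) \<and> s \<longlonglongrightarrow> 1 \<and> (\<lambda>n. f (\<omega> (\<gamma> (s n)))) \<longlonglongrightarrow> H t"
        using t(2) unfolding A_def by blast
      then obtain s :: "nat \<Rightarrow> real" where s: "\<forall>n. s n \<in> {0..<1}" "s \<longlonglongrightarrow> 1" "(\<lambda>n. f (\<omega> (\<gamma> (s n)))) \<longlonglongrightarrow> H t"
        by blast
      have "(\<lambda>n. \<gamma> (s n)) \<longlonglongrightarrow> \<gamma> 1"
        using s(1) by (intro continuous_on_tendsto_compose[OF \<gamma>(1) s(2)] always_eventually) (auto simp: less_imp_le)
      moreover have "(\<lambda>n. \<Omega> \<zeta> (\<gamma> (s n))) \<longlonglongrightarrow> complex_of_real (\<phi> \<zeta>)"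
        unfolding \<Omega>_def \<phi> by (intro tendsto_intros s(3))
      moreover have "\<forall>n. \<gamma> (s n) \<in> \<gamma> ` {0..<1}" using s(1) by blast
      ultimately have "\<exists>z. (\<forall>n. z n \<in> \<gamma> ` {0..<1}) \<and> z \<longlonglongrightarrow> \<zeta> \<and>
          (\<lambda>n. \<Omega> \<zeta> (z n)) \<longlonglongrightarrow> complex_of_real (\<phi> \<zeta>)"
        unfolding \<gamma>(3) by (intro exI[of _ "\<lambda>n. \<gamma> (s n)"] conjI)
      then show ?thesis
        unfolding cluster_along_def by (intro UnI1 CollectI exI[of _ "complex_of_real (\<phi> \<zeta>)"] conjI refl)
    qed
    then show "{Some (complex_of_real (\<phi> \<zeta>))} \<subseteq> principal_asymptotic_values D (\<Omega> \<zeta>) \<zeta>"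
      unfolding principal_asymptotic_values_def by simp
  qed
  have "{t \<in> {0..2*pi}. cis t \<in> \<omega> ` E} \<subseteq> N \<union> {t \<in> {0..2*pi}. cis t \<in> A}"
  proof
    fix t assume "t \<in> {t \<in> {0..2*pi}. cis t \<in> \<omega> ` E}"
    then have t: "t \<in> {0..2*pi}" and "cis t \<in> \<omega> ` E" by simp_all
    then obtain \<zeta> where \<zeta>: "\<zeta> \<in> E" "cis t = \<omega> \<zeta>" by (elim imageE)
    have "\<zeta> \<in> closure D" using \<zeta>(1) by (auto simp: E_def frontier_eq)
    then have "\<zeta> = \<omega>' (cis t)" using \<zeta>(2) inv_left by simp
    moreover have "principal_asymptotic_values D (\<Omega> \<zeta>) \<zeta> \<noteq> {Some (complex_of_real (\<phi> \<zeta>))}"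
      using \<zeta>(1) unfolding E_def by simp
    ultimately have "t \<in> N \<or> cis t \<in> A" using key[of t \<zeta>] t by blast
    then show "t \<in> N \<union> {t \<in> {0..2*pi}. cis t \<in> A}" using t by blast
  qed
  moreover have "N \<union> {t \<in> {0..2*pi}. cis t \<in> A} \<in> null_sets lebesgue"
    using N countable_radially_ambiguous_points[of f] unfolding A_def
    by (intro null_sets.Un cis_vimage_countable_null)
  ultimately have "hm_null D \<omega> E"
    unfolding hm_null_def circle_null_def
    unfolding negligible_iff_null_sets[symmetric] by (rule negligible_subset[rotated])
  moreover have "E \<subseteq> frontier D" by (auto simp: E_def)
  moreover have "(\<lambda>z. f (\<omega> z)) holomorphic_on D"
    using holomorphic_on_compose_gen[OF hol f] img by (simp add: comp_def)
  moreover have "\<forall>\<zeta>\<in>frontier D - E. principal_asymptotic_values D (\<Omega> \<zeta>) \<zeta> = {Some (complex_of_real (\<phi> \<zeta>))}"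
    by (simp add: E_def)
  ultimately show ?thesis
    unfolding classS_def \<Omega>_def by (intro CollectI conjI exI[of _ E])
qed

end

section \<open>Independent solutions from disjoint arcs\<close>

theorem theorem5p3:
  fixes D :: "complex set" and \<omega> lam :: "complex \<Rightarrow> complex" and \<phi> :: "complex \<Rightarrow> real"
  assumes "jordan_domain D"
    and "conformal_ext D \<omega>"
    and "\<And>\<zeta>. \<zeta> \<in> frontier D \<Longrightarrow> norm (lam \<zeta>) = 1"
    and "hm_measurable_fun D \<omega> lam"
    and "hm_measurable_fun D \<omega> \<phi>"
  shows "\<forall>n::nat. \<exists>f g :: nat \<Rightarrow> complex \<Rightarrow> complex.
           (\<forall>i<n. f i \<in> classS D \<omega> lam \<phi> \<and> g i \<in> classS D \<omega> lam \<phi>) \<and>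
           (\<forall>c :: nat \<Rightarrow> real.
              (\<forall>z\<in>D. (\<Sum>i<n. c i *\<^sub>R (f i z - g i z)) = 0) \<longrightarrow> (\<forall>i<n. c i = 0))"
proof
  fix n :: nat
  obtain \<omega>' where homeo: "homeomorphism (closure D) (cball 0 1) \<omega> \<omega>'"
    using assms(2) unfolding conformal_ext_def by blast
  have "open D"
    using assms(1) unfolding jordan_domain_def
    by (auto intro!: open_inside closed_path_image simple_path_imp_path)
  then interpret conformal_extension D \<omega> \<omega>'
    using assms(2) homeo by unfold_locales (auto simp: conformal_ext_def)
  define V where "V t = inv_into (closure D) \<omega> (cis t)" for t
  have V: "V t = \<omega>' (cis t)" for t unfolding V_def by (rule inv_into_eq) simp
  have lam1: "norm (lam (V t)) = 1" for t
    unfolding V by (intro assms(3) inv_sphere) simp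
  have meas_lam: "(\<lambda>t. lam (V t)) \<in> borel_measurable (lebesgue_on {0..2*pi})"
    using assms(4) unfolding hm_measurable_fun_def circle_measurable_fun_def V_def .
  have meas_\<phi>: "(\<lambda>t. \<phi> (V t)) \<in> borel_measurable (lebesgue_on {0..2*pi})"
    using assms(5) unfolding hm_measurable_fun_def circle_measurable_fun_def V_def .
  define J where "J i = {2*pi * real i / real n<..<2*pi * (real i + 1) / real n}" for i
  \<comment> \<open>\<open>None\<close> stands for the base solution, and \<open>Some i\<close> for
    the one whose free component is the indicator of the \<open>i\<close>-th of \<open>n\<close>
    disjoint intervals.\<close>
  define k :: "nat option \<Rightarrow> real \<Rightarrow> real"
    where "k = case_option (\<lambda>t. 0) (\<lambda>i. indicator (J i))"
  define H where "H a t = lam (V t) * Complex (\<phi> (V t)) (k a t)" for a t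
  have Re_H: "Re (cnj (lam (\<omega>' (cis t))) * H a t) = \<phi> (\<omega>' (cis t))" for a t
  proof -
    \<comment> \<open>As \<open>lam\<close> is unimodular, \<open>k\<close> only enters the
      imaginary part, which the boundary condition leaves free.\<close>
    have "cnj (lam (V t)) * H a t = (lam (V t) * cnj (lam (V t))) * Complex (\<phi> (V t)) (k a t)"
      by (simp add: H_def)
    also have "lam (V t) * cnj (lam (V t)) = 1"
      using lam1[of t] by (simp add: complex_norm_square[symmetric])
    finally show ?thesis by (simp add: V)
  qed
  have "H a \<in> borel_measurable (lebesgue_on {0..2*pi})" for a
  proof -
    have "k a \<in> borel_measurable (lebesgue_on {0..2*pi})"
    proof (cases a)
      case (Some i)
      have "(indicator (J i) :: real \<Rightarrow> real) \<in> borel_measurable lebesgue" unfolding J_def by (intro borel_measurable_indicator) simp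
      then show ?thesis by (simp add: k_def Some measurable_restrict_space1)
    qed (simp add: k_def)
    then show ?thesis
      unfolding H_def[abs_def] Complex_eq using meas_lam meas_\<phi> by measurable
  qed
  then have "\<exists>f N. f holomorphic_on ball 0 1 \<and> N \<in> null_sets lebesgue \<and>
    (\<forall>t\<in>{0..2*pi} - N. ((\<lambda>r. f (of_real r * cis t)) \<longlongrightarrow> H a t) (at_left 1))" for a
    by (intro exists_holomorphic_with_radial_limits)
  then obtain F N where F: "\<And>a. F a holomorphic_on ball 0 1" and N: "\<And>a. N a \<in> null_sets lebesgue"
    and lim: "\<And>a t. t \<in> {0..2*pi} - N a \<Longrightarrow> ((\<lambda>r. F a (of_real r * cis t)) \<longlongrightarrow> H a t) (at_left 1)"
    by metis
  have S: "(\<lambda>z. F a (\<omega> z)) \<in> classS D \<omega> lam \<phi>" for a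
    by (rule in_classS_if_radial_limits[OF F N lim Re_H])
  have independent: "c j = 0"
    if c: "\<forall>z\<in>D. (\<Sum>i<n. c i *\<^sub>R (F (Some i) (\<omega> z) - F None (\<omega> z))) = 0" and j: "j < n"
    for c :: "nat \<Rightarrow> real" and j
  proof -
    define N' where "N' = (\<Union>a\<in>insert None (Some ` {..<n}). N a)"
    have "N' \<in> null_sets lebesgue" unfolding N'_def by (intro null_sets.finite_UN N) auto
    moreover have "J j \<notin> null_sets lebesgue"
    proof -
      have "2*pi * real j / real n < 2*pi * (real j + 1) / real n"
        using j by (simp add: divide_strict_right_mono)
      then have "\<not> negligible (J j)"
        unfolding J_def by (intro open_not_negligible) auto
      then show ?thesis by (simp add: negligible_iff_null_sets)
    qed
    \<comment> \<open>A nonempty open interval is not null, so it contains an angle at which all the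
      radial limits exist together.\<close>
    ultimately have "\<not> J j \<subseteq> N'"
      by (metis negligible_iff_null_sets negligible_subset)
    then obtain t where t: "t \<in> J j" "t \<notin> N'" by blast
    have "t \<in> {0..2*pi}"
    proof -
      have "0 \<le> 2*pi * real j / real n" by simp
      moreover have "2*pi * (real j + 1) / real n \<le> 2*pi"
        using j by (simp add: divide_le_eq mult_left_mono)
      moreover have "2*pi * real j / real n < t" "t < 2*pi * (real j + 1) / real n"
        using t(1) unfolding J_def by simp_all
      ultimately have "0 \<le> t" "t \<le> 2*pi" by linarith+
      then show ?thesis by simp
    qed
    then have lims: "((\<lambda>r. F a (of_real r * cis t)) \<longlongrightarrow> H a t) (at_left 1)"
      if "a \<in> insert None (Some ` {..<n})" for a
      using t(2) that by (intro lim) (auto simp: N'_def)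
    have J_le: "a \<le> b" if "t \<in> J a" "t \<in> J b" for a b
    proof (rule ccontr)
      assume "\<not> a \<le> b"
      then have "2*pi * (real b + 1) / real n \<le> 2*pi * real a / real n"
        by (intro divide_right_mono mult_left_mono) auto
      moreover have "2*pi * real a / real n < t" "t < 2*pi * (real b + 1) / real n"
        using that unfolding J_def by simp_all
      ultimately show False by linarith
    qed
    have k_J: "k (Some i) t = (if i = j then 1 else 0)" for i
    proof (cases "i = j")
      case False
      then have "t \<notin> J i" using J_le[of i j] J_le[of j i] t(1) by force
      then show ?thesis using False by (simp add: k_def)
    qed (use t(1) in \<open>simp add: k_def\<close>)
    \<comment> \<open>The linear relation on \<open>D\<close> passes to the radial limits at
      \<open>t\<close>. There only the \<open>j\<close>-th boundary difference is nonzero, namely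
      \<open>lam (V t) * \<i>\<close>.\<close>
    have "((\<lambda>r. \<Sum>i<n. c i *\<^sub>R (F (Some i) (of_real r * cis t) - F None (of_real r * cis t)))
        \<longlongrightarrow> (\<Sum>i<n. c i *\<^sub>R (H (Some i) t - H None t))) (at_left 1)"
      by (intro tendsto_intros lims) auto
    moreover have "\<forall>\<^sub>F r in at_left 1.
        (\<Sum>i<n. c i *\<^sub>R (F (Some i) (of_real r * cis t) - F None (of_real r * cis t))) = 0"
      unfolding eventually_at_left[OF zero_less_one]
    proof (intro exI[of _ 0] conjI allI impI)
      fix r :: real assume r: "r > 0" "r < 1"
      then have "of_real r * cis t \<in> ball 0 1" by (simp add: norm_mult)
      then obtain z where "z \<in> D" "\<omega> z = of_real r * cis t" using img by (metis imageE)
      then show "(\<Sum>i<n. c i *\<^sub>R (F (Some i) (of_real r * cis t) - F None (of_real r * cis t))) = 0"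
        using c by metis
    qed simp
    ultimately have "((\<lambda>r::real. 0) \<longlongrightarrow> (\<Sum>i<n. c i *\<^sub>R (H (Some i) t - H None t))) (at_left 1)"
      by (rule Lim_transform_eventually)
    then have "0 = (\<Sum>i<n. c i *\<^sub>R (H (Some i) t - H None t))"
      by (intro tendsto_unique[OF trivial_limit_at_left_real tendsto_const])
    also have "\<dots> = (\<Sum>i<n. if i = j then c j *\<^sub>R (lam (V t) * \<i>) else 0)"
    proof (intro sum.cong refl)
      fix i assume "i \<in> {..<n}"
      have "H (Some i) t - H None t = lam (V t) * (of_real (k (Some i) t) * \<i>)"
        by (simp add: H_def right_diff_distrib[symmetric] k_def complex_eq_iff)
      then show "c i *\<^sub>R (H (Some i) t - H None t) = (if i = j then c j *\<^sub>R (lam (V t) * \<i>) else 0)"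
        using k_J[of i] by simp
    qed
    also have "\<dots> = c j *\<^sub>R (lam (V t) * \<i>)" using j by simp
    finally show "c j = 0" using lam1[of t] by auto
  qed
  show "\<exists>f g :: nat \<Rightarrow> complex \<Rightarrow> complex.
           (\<forall>i<n. f i \<in> classS D \<omega> lam \<phi> \<and> g i \<in> classS D \<omega> lam \<phi>) \<and>
           (\<forall>c :: nat \<Rightarrow> real.
              (\<forall>z\<in>D. (\<Sum>i<n. c i *\<^sub>R (f i z - g i z)) = 0) \<longrightarrow> (\<forall>i<n. c i = 0))"
    by (rule exI[of _ "\<lambda>i z. F (Some i) (\<omega> z)"], rule exI[of _ "\<lambda>i z. F None (\<omega> z)"])
      (use S independent in blast)
qed

end
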